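(* For every positive integer $n$, the number of signed partitions $\sigma=(\pi,\nu)$ of $n$ such that (i) $\pi_1$, the largest positive part, is even, (ii) the integers $1,2,\dots,\frac{\pi_1}{2}-1$ all appear as positive parts an even number of times and at least twice, (iii) the integers $\frac{\pi_1}{2},\frac{\pi_1}{2}+1,\dots,\pi_1$ all appear as positive parts at least once, and (iv) there are exactly $\frac{\pi_1}{2}$ negative parts (counted with multiplicity), each $\equiv 2\pmod 3$ and $\leq \frac{3\pi_1}{2}-1$, with the negative parts greater than $2$ occurring at most once, equals the number of (ordinary) partitions of $n$ into parts congruent to $\pm 1, \pm 3, \pm 4, \pm 6, \pm 8 \pmod{18}$.
   Context: A partition $\lambda$ of length $\ell=\ell(\lambda)$ is an $\ell$-tuple $(\lambda_1,\dots,\lambda_\ell)$ of positive integers (its parts) with $\lambda_i\geq\lambda_{i+1}$ for $1\le i\le \ell-1$; its weight is $|\lambda|=\sum_i\lambda_i$, and it is a partition of $n$ if $|\lambda|=n$. A signed partition $\sigma$ of an integer $n$ is a pair $(\pi,\nu)$ of partitions with $n=|\pi|-|\nu|$; the parts of $\pi$ are called the positive parts of $\sigma$ and the parts of $\nu$ (which are positive integers) are called the negative parts of $\sigma$. In the claim $\pi$ is nonempty (it has a largest part $\pi_1$); a list of integers such as $1,2,\dots,\frac{\pi_1}{2}-1$ is empty when its upper end is $0$. *)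

theory Defs
  imports "HOL-Number_Theory.Cong"
begin

text \<open>A partition is the weakly decreasing list of its parts; its length is \<open>length\<close>, its weight
  \<open>sum_list\<close>, and the multiplicity of a part is given by \<open>count_list\<close>.\<close>

definition is_partition :: "nat list \<Rightarrow> bool" where
  "is_partition l \<longleftrightarrow> sorted_wrt (\<ge>) l \<and> (\<forall>p\<in>set l. p > 0)"

definition partition_of :: "nat list \<Rightarrow> nat \<Rightarrow> bool" where
  "partition_of l n \<longleftrightarrow> is_partition l \<and> sum_list l = n"

definition signed_partition_of :: "nat list \<times> nat list \<Rightarrow> int \<Rightarrow> bool" where
  "signed_partition_of \<sigma> n \<longleftrightarrow>
     is_partition (fst \<sigma>) \<and> is_partition (snd \<sigma>) \<and>
     n = int (sum_list (fst \<sigma>)) - int (sum_list (snd \<sigma>))"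

text \<open>Only meaningful for a nonempty partition.\<close>

definition largest_part :: "nat list \<Rightarrow> nat" where
  "largest_part l = hd l"

end

theory Submission
  imports Defs Complex_Main "HOL-Computational_Algebra.Formal_Power_Series" "HOL-Library.Multiset"
begin

text \<open>Let \<open>m\<close> be half of the largest positive part. The proof computes the generating function
of the signed partitions with a given \<open>m\<close>, sums over \<open>m\<close>, and evaluates the sum as an infinite
product.

The negative parts are the numbers \<open>3 * i + 2\<close> for \<open>i\<close> in some set \<open>T \<subseteq> {1..<m}\<close>, padded by twos
to length \<open>m\<close>; they lower the weight by \<open>2 * m + 3 * \<Sum>T\<close>. The forced positive parts raise it by
\<open>m\<^sup>2 + 2 * m + 3 * \<Sum>{1..<m}\<close>, so a net weight \<open>m\<^sup>2 + 3 * \<Sum>({1..<m} - T)\<close> remains. Summing over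
the complement of \<open>T\<close> gives a factor \<open>\<Prod>i=1..<m. 1 + X ^ (3 * i)\<close>, and together with the free
multiplicities of the positive parts the class of \<open>m\<close> has generating function
\<open>X ^ m\<^sup>2 * bailey_beta m\<close>, where \<open>bailey_beta m\<close> is \<open>\<Prod>i=1..m-1. 1 - X ^ i + X ^ (2 * i)\<close> divided
by \<open>\<Prod>i=1..2*m. 1 - X ^ i\<close> (lemma \<open>signed_class_gf\<close>). With \<open>bailey_beta 0 = 1\<close>, which affects
only the constant coefficient, the claim becomes the Rogers-Ramanujan type identity
\<open>mod_18_identity\<close>: the sum of all \<open>X ^ m\<^sup>2 * bailey_beta m\<close> is the product of \<open>1 / (1 - X ^ p)\<close>
over the admissible parts \<open>p\<close>.

The identity is proved by Bailey's method. Since \<open>1 - x + x\<^sup>2 = (1 + \<omega> * x) * (1 + \<omega>\<^sup>2 * x)\<close> for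
a primitive cube root of unity \<open>\<omega>\<close>, the finite Jacobi triple product at \<open>\<omega>\<close> and at \<open>\<omega>\<^sup>2\<close> expands
\<open>bailey_beta\<close> in the terms \<open>chi3 r * X ^ (r * (r - 1) / 2)\<close>, with \<open>chi3\<close> periodic modulo 3
(\<open>bailey_beta_expansion\<close>). Bailey's lemma, which here is the \<open>q\<close>-Vandermonde sum, then
multiplies the \<open>r\<close>-th term by \<open>X ^ r\<^sup>2\<close>. In the limit the sum of all \<open>X ^ m\<^sup>2 * bailey_beta m\<close>,
times \<open>\<Prod>i. 1 - X ^ i\<close>, is the series \<open>bailey_theta\<close> of all \<open>chi3 r * X ^ (r * (3 * r - 1) / 2)\<close>
(\<open>bailey_identity\<close>). By the quintuple product identity this series is a product over residue
classes. That identity is obtained by multiplying \<open>bailey_theta\<close> with a theta series and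
regrouping the double series into a product of two other theta series
(\<open>quintuple_times_triple\<close>); the Jacobi triple product evaluates these three theta series, and
infinite products can be cancelled.

Everything takes place in the ring of formal power series over the complex numbers, which
contains the cube roots of unity; limits of power series are coefficientwise.\<close>

section \<open>Gaussian binomial coefficients and the finite triple product\<close>

lemma nat_eq_if_double_eq: "2 * int a = 2 * int b \<Longrightarrow> a = b"
  by simp

text \<open>The exponent in the triple product, as a natural number also for negative \<open>r\<close>.\<close>

definition tri :: "int \<Rightarrow> nat" where
  "tri r = nat (r * (r - 1) div 2)"

lemma tri_eq: "2 * int (tri r) = r * (r - 1)"
proof -
  have "0 \<le> r * (r - 1)"
    by (cases "r \<le> 0") (simp_all add: mult_nonpos_nonpos)
  thus ?thesis
    by (simp add: tri_def)
qed

lemma tri_of_nat_Suc: "tri (1 + int k) = tri (int k) + k"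
proof -
  have "2 * int (tri (1 + int k)) = 2 * int (tri (int k) + k)"
    using tri_eq[of "1 + int k"] tri_eq[of "int k"] by (simp add: algebra_simps)
  thus ?thesis by (rule nat_eq_if_double_eq)
qed

lemma tri_0 [simp]: "tri 0 = 0"
  by (simp add: tri_def)

definition qfac :: "'a::comm_ring_1 \<Rightarrow> nat \<Rightarrow> 'a" where
  "qfac q n = (\<Prod>i=1..n. 1 - q ^ i)"

lemma qfac_0 [simp]: "qfac q 0 = 1"
  by (simp add: qfac_def)

lemma qfac_Suc [simp]: "qfac q (Suc n) = qfac q n * (1 - q ^ Suc n)"
  by (simp add: qfac_def)

text \<open>The Gaussian binomial coefficient. The recursion makes sense in every commutative ring,
also where the factors \<open>1 - q ^ i\<close> have no inverse.\<close>

fun qbin :: "'a::comm_ring_1 \<Rightarrow> nat \<Rightarrow> nat \<Rightarrow> 'a" where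
  "qbin q n 0 = 1"
| "qbin q 0 (Suc k) = 0"
| "qbin q (Suc n) (Suc k) = qbin q n k + q ^ Suc k * qbin q n (Suc k)"

lemma qbin_eq_0: "n < k \<Longrightarrow> qbin q n k = 0"
  by (induction q n k rule: qbin.induct) auto

lemma qbin_mult_qfac:
  "k \<le> n \<Longrightarrow> qbin q n k * (qfac q k * qfac q (n - k)) = qfac q n"
proof (induction q n k rule: qbin.induct)
  case (3 q n k)
  show ?case
  proof (cases "k = n")
    case True
    hence "qbin q n n * qfac q n = qfac q n" using "3.IH"(1) by simp
    thus ?thesis using True by (simp add: qbin_eq_0 flip: mult.assoc)
  next
    case False
    hence "Suc k \<le> n" using 3 by simp
    then obtain j where j: "n = Suc (k + j)"
      using less_eqE by (metis add_Suc)
    have A: "qbin q n k * (qfac q k * (qfac q j * (1 - q ^ Suc j))) = qfac q n"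
      using "3.IH"(1) j by simp
    have B: "qbin q n (Suc k) * (qfac q k * (1 - q ^ Suc k) * qfac q j) = qfac q n"
      using "3.IH"(2) j by simp
    have "qbin q (Suc n) (Suc k) * (qfac q (Suc k) * qfac q (Suc n - Suc k)) =
          (1 - q ^ Suc k) * (qbin q n k * (qfac q k * (qfac q j * (1 - q ^ Suc j)))) +
          q ^ Suc k * (1 - q ^ Suc j) * (qbin q n (Suc k) *
              (qfac q k * (1 - q ^ Suc k) * qfac q j))"
      using j by (simp add: algebra_simps)
    also have "\<dots> = qfac q n * (1 - q ^ Suc k * q ^ Suc j)"
      unfolding A B by (simp add: algebra_simps)
    also have "q ^ Suc k * q ^ Suc j = q ^ Suc n"
      using j by (simp add: power_add algebra_simps)
    finally show ?thesis by simp
  qed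
qed auto

text \<open>Gauss's \<open>q\<close>-binomial theorem in homogeneous form. Splitting off the factor \<open>i = 0\<close>
replaces \<open>y\<close> by \<open>y * q\<close> in the remaining product, and the recursion of \<open>qbin\<close> is what recombines
the two resulting sums.\<close>

theorem q_binomial:
  fixes q x y :: "'a::comm_ring_1"
  shows "(\<Prod>i<M. x + y * q ^ i) =
           (\<Sum>k\<le>M. qbin q M k * q ^ tri (int k) * x ^ (M - k) * y ^ k)"
proof (induction M arbitrary: y)
  case (Suc M)
  let ?t = "\<lambda>k. qbin q M k * q ^ (tri (int k) + k) * y ^ k"
  have "(\<Prod>i<Suc M. x + y * q ^ i) = (x + y) * (\<Prod>i<M. x + (y * q) * q ^ i)"
    by (subst prod.lessThan_Suc_shift) (simp add: mult.assoc)
  also have "\<dots> = (x + y) * (\<Sum>k\<le>M. ?t k * x ^ (M - k))"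
    by (subst Suc.IH) (simp add: power_add power_mult_distrib mult_ac)
  also have "\<dots> = (\<Sum>k\<le>M. ?t k * x ^ (Suc M - k)) + (\<Sum>k\<le>M. ?t k * y * x ^ (M - k))"
    by (simp add: distrib_right sum_distrib_left Suc_diff_le sum.distrib mult_ac)
  also have "(\<Sum>k\<le>M. ?t k * x ^ (Suc M - k)) = (\<Sum>k\<le>Suc M. ?t k * x ^ (Suc M - k))"
    by (simp add: qbin_eq_0)
  also have "\<dots> = x ^ Suc M + (\<Sum>k\<le>M. ?t (Suc k) * x ^ (M - k))"
    by (subst sum.atMost_Suc_shift) simp
  also have "\<dots> + (\<Sum>k\<le>M. ?t k * y * x ^ (M - k)) =
      x ^ Suc M + (\<Sum>k\<le>M. qbin q (Suc M) (Suc k) * q ^ tri (int (Suc k)) *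
                            x ^ (M - k) * y ^ Suc k)"
    unfolding add.assoc sum.distrib [symmetric]
    by (intro arg_cong2[of _ _ _ _ "(+)"] refl sum.cong)
       (simp add: tri_of_nat_Suc power_add algebra_simps)
  also have "\<dots> = (\<Sum>k\<le>Suc M. qbin q (Suc M) k * q ^ tri (int k) * x ^ (Suc M - k) * y ^ k)"
    by (subst sum.atMost_Suc_shift) simp
  finally show ?case .
qed auto

text \<open>The case of \<open>2 * n\<close> factors with \<open>x = q ^ n\<close>: the first \<open>n\<close> factors contain a power of
\<open>q\<close>, the last \<open>n\<close> contain \<open>q ^ n\<close>, and every term of the sum contains the product of these
powers. The homogeneous form of the binomial theorem makes negative powers of \<open>q\<close> unnecessary,
but \<open>q\<close> has to be cancelled in the end.\<close>

theorem finite_jacobi_triple: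
  fixes q z :: "'a::idom"
  assumes "q \<noteq> 0"
  shows "(\<Prod>i=1..n. z + q ^ i) * (\<Prod>i<n. 1 + z * q ^ i) =
           (\<Sum>k\<le>2*n. qbin q (2*n) k * q ^ tri (int k - int n) * z ^ k)"
proof -
  \<comment> \<open>the exponent of the power of \<open>q\<close> that is common to all terms\<close>
  define c where "c = tri (int n) + n * n"
  have "q ^ c * ((\<Prod>i=1..n. z + q ^ i) * (\<Prod>i<n. 1 + z * q ^ i)) =
        (\<Prod>i<2*n. q ^ n + z * q ^ i)"
  proof -
    have "(\<Prod>i<2*n. q ^ n + z * q ^ i) =
            (\<Prod>i<n. q ^ n + z * q ^ i) * (\<Prod>i<n. q ^ n + z * q ^ (n + i))"
      using prod.nat_group[of "\<lambda>i. q ^ n + z * q ^ i" n 2]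
      by (simp add: numeral_2_eq_2 mult.commute prod.atLeastLessThan_shift_0 [of _ n "n + n"]
            lessThan_atLeast0 add.commute)
    also have "(\<Prod>i<n. q ^ n + z * q ^ (n + i)) = (\<Prod>i<n. q ^ n * (1 + z * q ^ i))"
      by (intro prod.cong) (auto simp: power_add algebra_simps)
    also have "\<dots> = q ^ (n * n) * (\<Prod>i<n. 1 + z * q ^ i)"
      by (simp add: prod.distrib power_mult)
    also have "(\<Prod>i<n. q ^ n + z * q ^ i) = (\<Prod>i<n. q ^ i * (z + q ^ (n - i)))"
      by (intro prod.cong refl) (simp add: algebra_simps flip: power_add)
    also have "\<dots> = (\<Prod>i<n. q ^ i) * (\<Prod>i<n. z + q ^ (n - i))"
      by (rule prod.distrib)
    also have "(\<Prod>i<n. q ^ i) = q ^ tri (int n)"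
      by (induction n) (simp_all add: tri_of_nat_Suc power_add)
    also have "(\<Prod>i<n. z + q ^ (n - i)) = (\<Prod>i=1..n. z + q ^ i)"
      by (rule prod.reindex_bij_witness[of _ "\<lambda>i. n - i" "\<lambda>i. n - i"]) auto
    finally show ?thesis
      by (simp add: c_def power_add mult_ac)
  qed
  also have "\<dots> = (\<Sum>k\<le>2*n. qbin q (2*n) k * q ^ tri (int k) * (q ^ n) ^ (2*n - k) * z ^ k)"
    by (rule q_binomial)
  also have "\<dots> = (\<Sum>k\<le>2*n. q ^ c * (qbin q (2*n) k * q ^ tri (int k - int n) * z ^ k))"
  proof (intro sum.cong refl)
    fix k assume k: "k \<in> {..2*n}"
    define j where "j = 2 * n - k"
    have j: "int j = 2 * int n - int k" using k by (simp add: j_def of_nat_diff)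
    have "2 * int (tri (int k) + n * j) = 2 * int (tri (int k)) + 2 * (int n * int j)" by simp
    also have "\<dots> = 2 * int (c + tri (int k - int n))"
      using tri_eq[of "int k"] tri_eq[of "int n"] tri_eq[of "int k - int n"]
      unfolding j by (simp add: c_def algebra_simps)
    finally have "2 * int (tri (int k) + n * (2*n - k)) = 2 * int (c + tri (int k - int n))"
      unfolding j_def .
    hence "tri (int k) + n * (2*n - k) = c + tri (int k - int n)"
      by (rule nat_eq_if_double_eq)
    hence "q ^ tri (int k) * (q ^ n) ^ (2*n - k) = q ^ c * q ^ tri (int k - int n)"
      by (simp only: flip: power_add power_mult)
    hence "qbin q (2*n) k * (q ^ tri (int k) * (q ^ n) ^ (2*n - k)) * z ^ k =
           qbin q (2*n) k * (q ^ c * q ^ tri (int k - int n)) * z ^ k"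
      by (simp only:)
    thus "qbin q (2*n) k * q ^ tri (int k) * (q ^ n) ^ (2*n - k) * z ^ k =
          q ^ c * (qbin q (2*n) k * q ^ tri (int k - int n) * z ^ k)"
      by (simp only: mult_ac)
  qed
  also have "\<dots> = q ^ c * (\<Sum>k\<le>2*n. qbin q (2*n) k * q ^ tri (int k - int n) * z ^ k)"
    by (simp add: sum_distrib_left)
  finally show ?thesis
    using assms by simp
qed

section \<open>The triple product at cube roots of unity\<close>

text \<open>The coefficients of the theta series in question; see \<open>chi3_eq_cube_roots\<close> for why they
arise.\<close>

definition chi3 :: "int \<Rightarrow> complex" where
  "chi3 r = (if r mod 3 = 0 then 1 else if r mod 3 = 2 then -1 else 0)"

text \<open>The product of \<open>\<Phi> (q ^ i)\<close> for \<open>i \<le> n\<close>, where \<open>\<Phi>\<close> is the sixth cyclotomic polynomial.\<close>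

definition cyclotomic6_prod :: "'a::comm_ring_1 \<Rightarrow> nat \<Rightarrow> 'a" where
  "cyclotomic6_prod q n = (\<Prod>i=1..n. 1 - q ^ i + q ^ (2 * i))"

lemma cyclotomic6_prod_0 [simp]: "cyclotomic6_prod q 0 = 1"
  by (simp add: cyclotomic6_prod_def)

text \<open>At a primitive cube root of unity \<open>w\<close> the two factors of the triple product are conjugate
up to a shift: \<open>w + q ^ i = w * (1 + w\<^sup>2 * q ^ i)\<close>, and
\<open>(1 + w\<^sup>2 * x) * (1 + w * x) = 1 - x + x\<^sup>2\<close>. The factors \<open>1 + w\<^sup>2 * q ^ Suc n\<close> and
\<open>1 + w = - w\<^sup>2\<close> have no partner.\<close>

lemma finite_triple_at_cube_root:
  fixes q w :: "'a::idom"
  assumes q: "q \<noteq> 0" and w: "w ^ 2 + w + 1 = 0"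
  shows "(\<Sum>k\<le>2*Suc n. qbin q (2*Suc n) k * q ^ tri (int k - int (Suc n)) * w ^ k) =
           - (w ^ (Suc n) * w ^ 2 * (1 + w ^ 2 * q ^ Suc n) * cyclotomic6_prod q n)"
proof -
  have w2: "w ^ 2 = - 1 - w" using w by (simp add: algebra_simps eq_neg_iff_add_eq_0)
  have "w * w ^ 2 = w * (- 1 - w)" by (simp only: w2)
  also have "\<dots> = - w - w ^ 2" by (simp add: algebra_simps power2_eq_square)
  finally have w3: "w * w ^ 2 = 1" by (simp add: w2)
  have A: "(\<Prod>i=1..Suc n. w + q ^ i) = (\<Prod>i=1..Suc n. w * (1 + w ^ 2 * q ^ i))"
    using w3 by (intro prod.cong refl) (simp add: distrib_left flip: mult.assoc)
  also have "\<dots> = w ^ Suc n * (\<Prod>i=1..Suc n. 1 + w ^ 2 * q ^ i)"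
    by (subst prod.distrib) simp
  also have "\<dots> = w ^ Suc n * ((\<Prod>i=1..n. 1 + w ^ 2 * q ^ i) * (1 + w ^ 2 * q ^ Suc n))"
    by simp
  finally have 1: "(\<Prod>i=1..Suc n. w + q ^ i) = \<dots>" .
  have "(\<Prod>i<Suc n. 1 + w * q ^ i) = (1 + w) * (\<Prod>i<n. 1 + w * q ^ Suc i)"
    by (subst prod.lessThan_Suc_shift) simp
  also have "(\<Prod>i<n. 1 + w * q ^ Suc i) = (\<Prod>i=1..n. 1 + w * q ^ i)"
    by (rule prod.reindex_bij_witness[of _ "\<lambda>i. i - 1" Suc]) auto
  also have "1 + w = - (w ^ 2)" using w2 by simp
  finally have 2: "(\<Prod>i<Suc n. 1 + w * q ^ i) = - (w ^ 2) * (\<Prod>i=1..n. 1 + w * q ^ i)" .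
  have 3: "(\<Prod>i=1..n. 1 + w ^ 2 * q ^ i) * (\<Prod>i=1..n. 1 + w * q ^ i) = cyclotomic6_prod q n"
    unfolding cyclotomic6_prod_def prod.distrib [symmetric]
  proof (intro prod.cong refl)
    fix i
    have "(1 + w ^ 2 * q ^ i) * (1 + w * q ^ i) =
            1 + (w ^ 2 + w) * q ^ i + (w * w ^ 2) * (q ^ i * q ^ i)"
      by (simp add: algebra_simps)
    also have "w ^ 2 + w = - 1" using w2 by simp
    finally show "(1 + w ^ 2 * q ^ i) * (1 + w * q ^ i) = 1 - q ^ i + q ^ (2 * i)"
      using w3 by (simp add: mult_2 power_add)
  qed
  have "(\<Sum>k\<le>2*Suc n. qbin q (2*Suc n) k * q ^ tri (int k - int (Suc n)) * w ^ k) =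
        (\<Prod>i=1..Suc n. w + q ^ i) * (\<Prod>i<Suc n. 1 + w * q ^ i)"
    by (rule finite_jacobi_triple [OF q, symmetric])
  also have "\<dots> = - (w ^ Suc n * w ^ 2 * (1 + w ^ 2 * q ^ Suc n) *
       ((\<Prod>i=1..n. 1 + w ^ 2 * q ^ i) * (\<Prod>i=1..n. 1 + w * q ^ i)))"
    unfolding 1 2 by (simp add: mult_ac)
  finally show ?thesis unfolding 3 .
qed

section \<open>The Bailey pair and Bailey's lemma\<close>

lemma qfac_nth_0: "b > 0 \<Longrightarrow> fps_nth (qfac (fps_X ^ b :: complex fps) n) 0 = 1"
proof (induction n)
  case (Suc n)
  have "fps_nth ((fps_X ^ b :: complex fps) ^ Suc n) 0 = 0"
    using Suc.prems by (simp add: fps_X_power_nth flip: power_mult)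
  thus ?case using Suc by (simp only: qfac_Suc fps_mult_nth_0 fps_sub_nth) simp
qed auto

definition inv_qfac :: "nat \<Rightarrow> complex fps" where
  "inv_qfac n = inverse (qfac fps_X n)"

lemma qfac_mult_inv_qfac: "qfac fps_X n * inv_qfac n = 1" "inv_qfac n * qfac fps_X n = 1"
  using qfac_nth_0[of 1 n] by (simp_all add: inv_qfac_def inverse_mult_eq_1 inverse_mult_eq_1')

lemma inv_qfac_Suc: "inv_qfac n = inv_qfac (Suc n) * (1 - fps_X ^ Suc n)"
proof -
  have "inv_qfac n = inv_qfac n * (qfac fps_X (Suc n) * inv_qfac (Suc n))"
    by (simp only: qfac_mult_inv_qfac mult_1_right)
  also have "\<dots> = (inv_qfac n * qfac fps_X n) * (inv_qfac (Suc n) * (1 - fps_X ^ Suc n))"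
    unfolding qfac_Suc by (simp only: mult_ac)
  finally show ?thesis by (simp only: qfac_mult_inv_qfac mult_1_left)
qed

lemma inv_qfac_0 [simp]: "inv_qfac 0 = 1"
  by (simp add: inv_qfac_def)

lemma qbin_conv_inv_qfac: "k \<le> n \<Longrightarrow> qbin fps_X n k = qfac fps_X n * (inv_qfac k * inv_qfac (n - k))"
proof -
  assume "k \<le> n"
  have "qbin fps_X n k = qbin fps_X n k * ((qfac fps_X k * inv_qfac k) *
      (qfac fps_X (n - k) * inv_qfac (n - k)))"
    by (simp only: qfac_mult_inv_qfac mult_1_right)
  also have "\<dots> = qbin fps_X n k * (qfac fps_X k * qfac fps_X (n - k)) *
      (inv_qfac k * inv_qfac (n - k))"
    by (simp only: mult_ac)
  finally show ?thesis using \<open>k \<le> n\<close> by (simp only: qbin_mult_qfac)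
qed

text \<open>Induction on \<open>M\<close>: after Pascal's rule for \<open>qbin\<close>, replacing \<open>inv_qfac (j + s)\<close> by
\<open>inv_qfac (j + s + 1) * (1 - X ^ (j + s + 1))\<close> in the first part makes its subtracted half
cancel the second part, and the sum for \<open>M\<close> and \<open>Suc s\<close> remains.\<close>

lemma q_vandermonde:
  "(\<Sum>j\<le>M. fps_X ^ (j * (j + s)) * qbin fps_X M j * inv_qfac (j + s)) = inv_qfac (M + s)"
proof (induction M arbitrary: s)
  case (Suc M)
  let ?X = "fps_X :: complex fps"
  let ?a = "\<lambda>s j. ?X ^ (j * (j + s)) * qbin ?X M j * inv_qfac (j + s)"
  have ext: "(\<Sum>j\<le>Suc M. f j * qbin ?X M j * g j) = (\<Sum>j\<le>M. f j * qbin ?X M j * g j)" for f g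
    by (simp add: qbin_eq_0)
  have "(\<Sum>j\<le>Suc M. ?X ^ (j * (j + s)) * qbin ?X (Suc M) j * inv_qfac (j + s)) =
        (\<Sum>j\<le>Suc M. ?X ^ (j * (j + s) + j) * qbin ?X M j * inv_qfac (j + s)) +
        (\<Sum>j\<le>M. ?X ^ (Suc j * (Suc j + s)) * qbin ?X M j * inv_qfac (Suc j + s))"
    by (subst (1 2) sum.atMost_Suc_shift)
       (simp add: power_add algebra_simps flip: sum.distrib)
  also have "\<dots> = (\<Sum>j\<le>M. ?X ^ (j * (j + s) + j) * qbin ?X M j * inv_qfac (j + s) +
                   ?X ^ (Suc j * (Suc j + s)) * qbin ?X M j * inv_qfac (Suc j + s))"
    unfolding ext sum.distrib ..
  also have "\<dots> = (\<Sum>j\<le>M. ?a (Suc s) j)"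
  proof (intro sum.cong refl)
    fix j
    have "?X ^ (j * (j + s) + j) * qbin ?X M j * inv_qfac (j + s) =
            ?X ^ (j * (j + s) + j) * qbin ?X M j *
                (inv_qfac (Suc (j + s)) * (1 - ?X ^ Suc (j + s)))"
      by (subst inv_qfac_Suc) (rule refl)
    moreover have "?X ^ (Suc j * (Suc j + s)) = ?X ^ (j * (j + s) + j) * ?X ^ Suc (j + s)"
      by (simp add: algebra_simps flip: power_add power_Suc)
    moreover have "j * (j + Suc s) = j * (j + s) + j" by simp
    ultimately show "?X ^ (j * (j + s) + j) * qbin ?X M j * inv_qfac (j + s) +
                   ?X ^ (Suc j * (Suc j + s)) * qbin ?X M j * inv_qfac (Suc j + s) = ?a (Suc s) j"
      by (simp only: add_Suc add_Suc_right) (simp add: algebra_simps)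
  qed
  finally show ?case using Suc.IH[of "Suc s"] by (simp only: add_Suc add_Suc_right)
qed simp

lemma q_vandermonde_symmetric:
  "(\<Sum>j\<le>M. fps_X ^ (j * (j + s)) * inv_qfac (M - j) * inv_qfac j * inv_qfac (j + s)) =
      inv_qfac M * inv_qfac (M + s)"
proof -
  have "(\<Sum>j\<le>M. fps_X ^ (j * (j + s)) * inv_qfac (M - j) * inv_qfac j * inv_qfac (j + s)) =
        inv_qfac M * (\<Sum>j\<le>M. fps_X ^ (j * (j + s)) * qbin fps_X M j * inv_qfac (j + s))"
    unfolding sum_distrib_left
  proof (intro sum.cong refl)
    fix j assume "j \<in> {..M}"
    hence "inv_qfac M * (fps_X ^ (j * (j + s)) * qbin fps_X M j * inv_qfac (j + s)) =
           (inv_qfac M * qfac fps_X M) * (fps_X ^ (j * (j + s)) * inv_qfac (M - j) * inv_qfac j *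
               inv_qfac (j + s))"
      by (simp only: qbin_conv_inv_qfac atMost_iff mult_ac)
    thus "fps_X ^ (j * (j + s)) * inv_qfac (M - j) * inv_qfac j * inv_qfac (j + s) =
          inv_qfac M * (fps_X ^ (j * (j + s)) * qbin fps_X M j * inv_qfac (j + s))"
      by (simp only: qfac_mult_inv_qfac mult_1_left)
  qed
  thus ?thesis by (simp only: q_vandermonde)
qed

text \<open>This is what Bailey's lemma needs: multiplying the kernel \<open>1 / ((q)\<^bsub>n-r\<^esub> (q)\<^bsub>n+r\<^esub>)\<close> of a
Bailey pair by \<open>X ^ n\<^sup>2 / (q)\<^bsub>N-n\<^esub>\<close> and summing over \<open>n\<close> reproduces the kernel with \<open>N\<close> in place
of \<open>n\<close>, up to \<open>X ^ r\<^sup>2\<close>.\<close>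

lemma bailey_kernel:
  fixes r :: int
  assumes "\<bar>r\<bar> \<le> int N"
  shows "(\<Sum>n=nat \<bar>r\<bar>..N. fps_X ^ (n^2) * inv_qfac (N - n) *
      (inv_qfac (nat (int n - r)) * inv_qfac (nat (int n + r)))) =
         fps_X ^ nat (r^2) * (inv_qfac (nat (int N - r)) * inv_qfac (nat (int N + r)))"
proof -
  define s where "s = nat \<bar>r\<bar>"
  have s: "int s = \<bar>r\<bar>" by (simp add: s_def)
  define M where "M = N - s"
  have N: "N = M + s" using assms s by (simp add: M_def)
  have sym: "inv_qfac (nat (int n - r)) * inv_qfac (nat (int n + r)) =
      inv_qfac (n - s) * inv_qfac (n + s)" for n
  proof (cases "r \<ge> 0")
    case True
    hence "r = int s" using s by simp
    thus ?thesis by (simp add: nat_minus_as_int nat_int_add)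
  next
    case False
    hence "r = - int s" using s by simp
    thus ?thesis by (simp add: nat_minus_as_int nat_int_add mult.commute)
  qed
  have r2: "nat (r^2) = s^2" using s by (metis nat_int of_nat_power power2_abs)
  let ?f = "\<lambda>n. fps_X ^ (n^2) * inv_qfac (N - n) * (inv_qfac (n - s) * inv_qfac (n + s))"
  have "sum ?f {s..N} = (\<Sum>j\<le>M. ?f (j + s))"
    using sum.shift_bounds_cl_nat_ivl[of ?f 0 s M] by (simp only: N atMost_atLeast0 add_0)
  also have "\<dots> = (\<Sum>j\<le>M. fps_X ^ (s^2) * (fps_X ^ (j * (j + 2*s)) * inv_qfac (M - j) * inv_qfac j *
      inv_qfac (j + 2*s)))"
  proof (intro sum.cong refl)
    fix j
    have "(j + s)^2 = s^2 + j * (j + 2*s)" by (simp add: power2_eq_square algebra_simps)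
    moreover have "N - (j + s) = M - j" "j + s - s = j" "j + s + s = j + 2 * s" using N by simp_all
    ultimately show "?f (j + s) = fps_X ^ (s^2) *
        (fps_X ^ (j * (j + 2*s)) * inv_qfac (M - j) * inv_qfac j * inv_qfac (j + 2*s))"
      by (simp only: power_add mult_ac)
  qed
  also have "\<dots> = fps_X ^ (s^2) * (inv_qfac M * inv_qfac (M + 2*s))"
    by (simp only: q_vandermonde_symmetric flip: sum_distrib_left)
  also have "M + 2 * s = N + s" using N by simp
  finally show ?thesis unfolding sym r2 s_def[symmetric] M_def .
qed

text \<open>The truncated subtraction gives \<open>bailey_beta 0 = 1\<close>, which is the value that the expansion
\<open>bailey_beta_expansion\<close> requires.\<close>

definition bailey_beta :: "nat \<Rightarrow> complex fps" where
  "bailey_beta n = cyclotomic6_prod fps_X (n - 1) * inv_qfac (2 * n)"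

text \<open>A function of period 3 is a combination of the powers of the three cube roots of unity.
The coefficient of the trivial root is the mean of the values \<open>1, 0, -1\<close> and vanishes. The two
relations between \<open>u\<close> and \<open>v\<close> are the values at 1 and 2.\<close>

lemma chi3_eq_cube_roots:
  obtains \<omega> u v :: complex where "\<omega>^2 + \<omega> + 1 = 0" "u * \<omega> + v * \<omega>^2 = 0" "u * \<omega>^2 + v * \<omega> = -1"
     "\<And>s. chi3 (int s) = u * \<omega> ^ s + v * (\<omega>^2) ^ s"
proof -
  define \<omega> where "\<omega> = Complex (-1/2) (sqrt 3 / 2)"
  have w: "\<omega>^2 + \<omega> + 1 = 0"
    by (simp add: \<omega>_def complex_eq_iff power2_eq_square)
  hence w2: "\<omega>^2 = - 1 - \<omega>" by (simp add: algebra_simps eq_neg_iff_add_eq_0)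
  have "\<omega> * \<omega>^2 = \<omega> * (- 1 - \<omega>)" by (simp only: w2)
  also have "\<dots> = - \<omega> - \<omega>^2" by (simp add: algebra_simps power2_eq_square)
  finally have w3: "\<omega> * \<omega>^2 = 1" by (simp add: w2)
  have ne: "1 - \<omega> \<noteq> 0" by (simp add: \<omega>_def complex_eq_iff)
  define v where "v = 1 / (1 - \<omega>)"
  define u where "u = - (\<omega> * v)"
  have v: "v * (1 - \<omega>) = 1" using ne by (simp add: v_def)
  have 1: "u + v = 1" using v by (simp add: u_def algebra_simps)
  have 2: "u * \<omega> + v * \<omega>^2 = 0" by (simp add: u_def power2_eq_square)
  have "u * \<omega>^2 + v * \<omega> = - (v * (\<omega> * \<omega>^2)) + v * \<omega>" by (simp add: u_def)
  also have "\<dots> = -1" using v unfolding w3 by (simp add: algebra_simps)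
  finally have 3: "u * \<omega>^2 + v * \<omega> = -1" .
  have "chi3 (int s) = u * \<omega> ^ s + v * (\<omega>^2) ^ s" for s
  proof -
    define t where "t = s div 3"
    have w3': "\<omega> ^ 3 = 1" using w3 by (simp add: power_Suc[of _ "Suc (Suc 0)"] numeral_3_eq_3
        power2_eq_square)
    have "(\<omega>^2) ^ 3 = (\<omega>^3) ^ 2" by (simp flip: power_mult)
    hence w6: "(\<omega>^2) ^ 3 = 1" using w3' by simp
    have pow: "\<omega> ^ (3 * t + j) = \<omega> ^ j" "(\<omega>^2) ^ (3 * t + j) = (\<omega>^2) ^ j" for j
      by (simp_all only: power_add power_mult w3' w6 power_one mult_1_left)
    have w4: "(\<omega>^2)^2 = \<omega>" using w3 by (simp add: power2_eq_square mult.assoc)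
    consider "s = 3 * t" | "s = 3 * t + 1" | "s = 3 * t + 2" unfolding t_def by linarith
    thus ?thesis
    proof cases
      case 1
      hence "\<omega> ^ s = 1" "(\<omega>^2) ^ s = 1" using pow[of 0] by simp_all
      thus ?thesis using \<open>u + v = 1\<close> 1 by (simp add: chi3_def)
    next
      case 2
      have "\<omega> ^ s = \<omega>" "(\<omega>^2) ^ s = \<omega>^2" using pow[of 1] unfolding 2
        by (simp_all only: power_one_right)
      moreover have "int s mod 3 = 1" using 2 by simp
      ultimately show ?thesis using \<open>u * \<omega> + v * \<omega>^2 = 0\<close> by (simp add: chi3_def)
    next
      case 3
      have "\<omega> ^ s = \<omega>^2" "(\<omega>^2) ^ s = \<omega>" using pow[of 2] unfolding 3 by (simp_all only: w4)
      moreover have "int s mod 3 = 2" using 3 by simp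
      ultimately show ?thesis using \<open>u * \<omega>^2 + v * \<omega> = -1\<close> by (simp add: chi3_def)
    qed
  qed
  thus ?thesis using w 2 3 that by blast
qed

lemma chi3_add_mult_3: "chi3 (r + 3 * t) = chi3 r"
  by (simp add: chi3_def)

text \<open>In the combination of the triple products at \<open>\<omega>\<close> and \<open>\<omega>\<^sup>2\<close> that produces the coefficients
\<open>chi3\<close>, the unpaired factors \<open>1 + \<omega>\<^sup>2 * X ^ Suc n\<close> and \<open>1 + \<omega> * X ^ Suc n\<close> combine to a
constant.\<close>

lemma triple_product_chi3:
  "(\<Sum>k\<le>2*Suc n. qbin fps_X (2*Suc n) k * fps_X ^ tri (int k - int (Suc n)) *
       fps_const (chi3 (int k - int (Suc n)))) = cyclotomic6_prod fps_X n"
proof -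
  obtain \<omega> u v where w: "\<omega>^2 + \<omega> + 1 = 0" and 2: "u * \<omega> + v * \<omega>^2 = 0" and 3: "u * \<omega>^2 + v * \<omega> = -1"
    and chi3: "\<And>s. chi3 (int s) = u * \<omega> ^ s + v * (\<omega>^2) ^ s"
    using chi3_eq_cube_roots by metis
  let ?m = "Suc n" and ?X = "fps_X :: complex fps"
  have w2: "\<omega>^2 = - 1 - \<omega>" using w by (simp add: algebra_simps eq_neg_iff_add_eq_0)
  have "\<omega> * \<omega>^2 = \<omega> * (- 1 - \<omega>)" by (simp only: w2)
  also have "\<dots> = - \<omega> - \<omega>^2" by (simp add: algebra_simps power2_eq_square)
  finally have w3: "\<omega> * \<omega>^2 = 1" by (simp add: w2)
  have w4: "(\<omega>^2)^2 = \<omega>" using w3 by (simp add: power2_eq_square mult.assoc)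
  have w': "(\<omega>^2)^2 + \<omega>^2 + 1 = 0" unfolding w4 using w by (simp add: add_ac)
  \<comment> \<open>the factors \<open>\<omega> ^ (-n)\<close> and \<open>\<omega> ^ n\<close> of the index shift, written with non-negative exponents\<close>
  define a b where "a = u * \<omega> ^ (2 * ?m)" and "b = v * \<omega> ^ ?m"
  have chi3': "chi3 (int k - int ?m) = a * \<omega> ^ k + b * (\<omega>^2) ^ k" for k
  proof -
    have "chi3 (int k - int ?m) = chi3 (int (k + 2 * ?m))"
      using chi3_add_mult_3[of "int k - int ?m" "int ?m"] by (simp add: algebra_simps)
    also have "(\<omega>^2) ^ (k + 2 * ?m) = (\<omega>^2) ^ k * ((\<omega>^2)^2) ^ ?m"
      by (simp only: power_add power_mult)
    hence "chi3 (int (k + 2 * ?m)) = a * \<omega> ^ k + b * (\<omega>^2) ^ k"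
      unfolding chi3 by (simp only: a_def b_def power_add w4 mult_ac)
    finally show ?thesis .
  qed
  let ?S = "\<lambda>z. (\<Sum>k\<le>2*?m. qbin ?X (2*?m) k * ?X ^ tri (int k - int ?m) * fps_const z ^ k)"
  have S: "?S z = - (fps_const (z ^ ?m * z^2) * (1 + fps_const (z^2) * ?X ^ ?m) *
      cyclotomic6_prod ?X n)"
    if "z^2 + z + 1 = 0" for z
  proof -
    have "fps_const z ^ 2 + fps_const z + 1 = 0"
      unfolding fps_const_power fps_const_add fps_const_1_eq_1[symmetric] using that by simp
    from finite_triple_at_cube_root[OF _ this, of ?X n] show ?thesis
      by (simp only: fps_X_neq_zero not_False_eq_True fps_const_power fps_const_mult simp_thms)
  qed
  have "(\<Sum>k\<le>2*?m. qbin ?X (2*?m) k * ?X ^ tri (int k - int ?m) *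
      fps_const (chi3 (int k - int ?m))) =
        fps_const a * ?S \<omega> + fps_const b * ?S (\<omega>^2)"
    unfolding chi3' sum_distrib_left sum.distrib[symmetric]
    by (intro sum.cong refl)
       (simp only: fps_const_power fps_const_mult[symmetric] fps_const_add[symmetric] distrib_left
           distrib_right mult_ac)
  also have "\<dots> = - (fps_const (a * (\<omega> ^ ?m * \<omega>^2) + b * ((\<omega>^2) ^ ?m * \<omega>)) +
                     fps_const (a * (\<omega> ^ ?m * \<omega>^2) * \<omega>^2 + b * ((\<omega>^2) ^ ?m * \<omega>) * \<omega>) * ?X ^ ?m) *
                         cyclotomic6_prod ?X n"
  proof -
    have ring: "A * - (P * (1 + R * x) * C) + B * - (Q * (1 + T * x) * C) =
                - (A * P + B * Q + (A * P * R + B * Q * T) * x) * C"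
      for A B C P Q R T x :: "complex fps" by (simp add: algebra_simps)
    show ?thesis unfolding S[OF w] S[OF w'] w4 ring fps_const_mult fps_const_add ..
  qed
  also have "a * (\<omega> ^ ?m * \<omega>^2) = u * \<omega>^2"
  proof -
    have "a * (\<omega> ^ ?m * \<omega>^2) = u * (\<omega> * \<omega>^2) ^ ?m * \<omega>^2"
      unfolding a_def power_mult power_mult_distrib by (simp only: mult_ac)
    thus ?thesis unfolding w3 by simp
  qed
  also have "b * ((\<omega>^2) ^ ?m * \<omega>) = v * \<omega>"
  proof -
    have "b * ((\<omega>^2) ^ ?m * \<omega>) = v * (\<omega> * \<omega>^2) ^ ?m * \<omega>"
      unfolding b_def power_mult_distrib by (simp only: mult_ac)
    thus ?thesis unfolding w3 by simp
  qed
  also have "u * \<omega>^2 * \<omega>^2 + v * \<omega> * \<omega> = 0"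
  proof -
    have "u * \<omega>^2 * \<omega>^2 = u * (\<omega>^2)^2" by (simp only: power2_eq_square mult_ac)
    hence "u * \<omega>^2 * \<omega>^2 = u * \<omega>" unfolding w4 .
    moreover have "v * \<omega> * \<omega> = v * \<omega>^2" by (simp only: power2_eq_square mult_ac)
    ultimately show ?thesis using 2 by (simp only:)
  qed
  finally show ?thesis unfolding 3 by simp
qed

text \<open>In the usual terminology, \<open>bailey_beta\<close> and \<open>r \<mapsto> chi3 r * X ^ tri r\<close> form a Bailey pair
relative to 1, with the terms for \<open>r\<close> and \<open>-r\<close> kept apart.\<close>

lemma bailey_beta_expansion:
  "bailey_beta n = (\<Sum>r=-int n..int n. fps_const (chi3 r) * fps_X ^ tri r *
                                  (inv_qfac (nat (int n - r)) * inv_qfac (nat (int n + r))))"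
proof (cases n)
  case 0
  thus ?thesis by (simp add: bailey_beta_def chi3_def)
next
  case (Suc m)
  have "bailey_beta n = inv_qfac (2*n) * cyclotomic6_prod fps_X m" using Suc
    by (simp add: bailey_beta_def mult.commute)
  also have "\<dots> = inv_qfac (2*n) * (\<Sum>k\<le>2*n. qbin fps_X (2*n) k * fps_X ^ tri (int k - int n) *
       fps_const (chi3 (int k - int n)))"
    unfolding Suc triple_product_chi3 ..
  also have "\<dots> = (\<Sum>k\<le>2*n. fps_const (chi3 (int k - int n)) * fps_X ^ tri (int k - int n) *
                               (inv_qfac (2*n - k) * inv_qfac k))"
    unfolding sum_distrib_left
  proof (intro sum.cong refl)
    fix k assume "k \<in> {..2*n}"
    hence "qbin fps_X (2*n) k = qfac fps_X (2*n) * (inv_qfac k * inv_qfac (2*n - k))"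
      by (intro qbin_conv_inv_qfac) simp
    hence "inv_qfac (2*n) * (qbin fps_X (2*n) k * fps_X ^ tri (int k - int n) *
        fps_const (chi3 (int k - int n))) =
       (inv_qfac (2*n) * qfac fps_X (2*n)) * (fps_const (chi3 (int k - int n)) *
           fps_X ^ tri (int k - int n) * (inv_qfac (2*n - k) * inv_qfac k))"
      by (simp only: mult_ac)
    thus "inv_qfac (2*n) * (qbin fps_X (2*n) k * fps_X ^ tri (int k - int n) *
        fps_const (chi3 (int k - int n))) =
       fps_const (chi3 (int k - int n)) * fps_X ^ tri (int k - int n) *
           (inv_qfac (2*n - k) * inv_qfac k)"
      by (simp only: qfac_mult_inv_qfac mult_1_left)
  qed
  also have "\<dots> = (\<Sum>r=-int n..int n. fps_const (chi3 r) * fps_X ^ tri r *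
                                  (inv_qfac (nat (int n - r)) * inv_qfac (nat (int n + r))))"
    by (rule sum.reindex_bij_witness[of _ "\<lambda>r. nat (r + int n)" "\<lambda>k. int k - int n"])
       (auto simp: nat_diff_distrib' add.commute intro!: arg_cong2[of _ _ _ _ "(*)"]
           arg_cong[of _ _ inv_qfac])
  finally show ?thesis .
qed

text \<open>This is the pentagonal number \<open>r * (3 * r - 1) / 2\<close> (lemma \<open>bailey_exp_eq\<close>).\<close>

definition bailey_exp :: "int \<Rightarrow> nat" where
  "bailey_exp r = tri r + nat (r^2)"

theorem finite_bailey_identity:
  "(\<Sum>n\<le>N. inv_qfac (N - n) * bailey_beta n * fps_X ^ (n^2)) =
   (\<Sum>r=-int N..int N. fps_const (chi3 r) * (inv_qfac (nat (int N - r)) *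
       inv_qfac (nat (int N + r))) *
       fps_X ^ bailey_exp r)"
proof -
  have "(\<Sum>n\<le>N. inv_qfac (N - n) * bailey_beta n * fps_X ^ (n^2)) =
        (\<Sum>n\<le>N. \<Sum>r=-int n..int n. fps_const (chi3 r) * fps_X ^ tri r *
            (fps_X ^ (n^2) * inv_qfac (N - n) *
                                  (inv_qfac (nat (int n - r)) * inv_qfac (nat (int n + r)))))"
    unfolding bailey_beta_expansion sum_distrib_left sum_distrib_right
    by (intro sum.cong refl) (simp only: mult_ac)
  also have "\<dots> = (\<Sum>r=-int N..int N. \<Sum>n=nat \<bar>r\<bar>..N. fps_const (chi3 r) * fps_X ^ tri r *
      (fps_X ^ (n^2) * inv_qfac (N - n) *
                                  (inv_qfac (nat (int n - r)) * inv_qfac (nat (int n + r)))))"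
    unfolding sum.Sigma[OF finite_atMost ballI[OF finite_atLeastAtMost_int]]
              sum.Sigma[OF finite_atLeastAtMost_int ballI[OF finite_atLeastAtMost]]
    by (rule sum.reindex_bij_witness[of _ "\<lambda>(r, n). (n, r)" "\<lambda>(n, r). (r, n)"]) auto
  also have "\<dots> = (\<Sum>r=-int N..int N. fps_const (chi3 r) *
      (inv_qfac (nat (int N - r)) * inv_qfac (nat (int N + r))) *
       fps_X ^ bailey_exp r)"
    unfolding sum_distrib_left[symmetric]
    by (intro sum.cong refl, subst bailey_kernel) (auto simp: bailey_exp_def power_add mult_ac)
  finally show ?thesis .
qed

section \<open>Infinite series of power series\<close>

lemma fps_mult_nth_cong:
  assumes "\<And>j. j \<le> k \<Longrightarrow> fps_nth f j = fps_nth f' j" "\<And>j. j \<le> k \<Longrightarrow> fps_nth g j = fps_nth g' j"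
  shows "fps_nth (f * g) k = fps_nth (f' * g') k"
  unfolding fps_mult_nth by (intro sum.cong) (use assms in auto)

lemma tendsto_mult_fps:
  fixes f g :: "'b \<Rightarrow> 'a::comm_ring_1 fps"
  assumes "(f \<longlongrightarrow> a) F" "(g \<longlongrightarrow> b) F"
  shows "((\<lambda>x. f x * g x) \<longlongrightarrow> a * b) F"
proof (rule tendsto_fpsI)
  fix k
  have "eventually (\<lambda>x. \<forall>j\<in>{..k}. fps_nth (f x) j = fps_nth a j) F"
       "eventually (\<lambda>x. \<forall>j\<in>{..k}. fps_nth (g x) j = fps_nth b j) F"
    using assms by (auto simp: tendsto_fps_iff eventually_ball_finite_distrib)
  thus "eventually (\<lambda>x. fps_nth (f x * g x) k = fps_nth (a * b) k) F"
    by eventually_elim (rule fps_mult_nth_cong, auto)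
qed

definition locally_finite :: "'i set \<Rightarrow> ('i \<Rightarrow> nat) \<Rightarrow> bool" where
  "locally_finite I e \<longleftrightarrow> (\<forall>k. finite {i\<in>I. e i \<le> k})"

text \<open>The sum of \<open>G i * X ^ e i\<close> over all \<open>i \<in> I\<close>. A coefficient collects only terms with
\<open>e i \<le> k\<close>, so it is the intended one as soon as \<open>e\<close> is locally finite on \<open>I\<close>.\<close>

definition fps_series :: "'i set \<Rightarrow> ('i \<Rightarrow> nat) \<Rightarrow> ('i \<Rightarrow> complex fps) \<Rightarrow> complex fps" where
  "fps_series I e G = Abs_fps (\<lambda>k. \<Sum>i\<in>{i\<in>I. e i \<le> k}. fps_nth (G i) (k - e i))"

lemma fps_series_nth_eq:
  assumes "finite J" "J \<subseteq> I" "\<And>i. i \<in> I \<Longrightarrow> e i \<le> k \<Longrightarrow> i \<in> J" "j \<le> k"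
  shows "fps_nth (fps_series I e G) j = fps_nth (\<Sum>i\<in>J. G i * fps_X ^ e i) j"
proof -
  have "fps_nth (\<Sum>i\<in>J. G i * fps_X ^ e i) j =
          (\<Sum>i\<in>J. if e i \<le> j then fps_nth (G i) (j - e i) else 0)"
    unfolding fps_sum_nth by (intro sum.cong refl) (simp add: fps_X_power_mult_right_nth)
  also have "\<dots> = (\<Sum>i\<in>{i\<in>J. e i \<le> j}. fps_nth (G i) (j - e i))"
    using assms(1) by (subst sum.inter_filter) auto
  also have "{i\<in>J. e i \<le> j} = {i\<in>I. e i \<le> j}"
    using assms(2,4) assms(3)[OF _ le_trans[OF _ assms(4)]] by blast
  finally show ?thesis by (simp add: fps_series_def)
qed

lemma fps_series_nth:
  assumes "locally_finite I e" "j \<le> k"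
  shows "fps_nth (fps_series I e G) j = fps_nth (\<Sum>i\<in>{i\<in>I. e i \<le> k}. G i * fps_X ^ e i) j"
  using assms by (intro fps_series_nth_eq) (auto simp: locally_finite_def)

text \<open>The analogue of Tannery's theorem for power series: a coefficient of the limit involves
only finitely many terms, and each of them is eventually present and stationary.\<close>

lemma fps_series_tendsto:
  assumes lf: "locally_finite I e"
    and g: "\<And>i. i \<in> I \<Longrightarrow> ((\<lambda>N. g N i) \<longlongrightarrow> G i) sequentially"
    and J: "\<And>N. finite (J N)" "\<And>N. J N \<subseteq> I" "\<And>i. i \<in> I \<Longrightarrow> eventually (\<lambda>N. i \<in> J N) sequentially"
  shows "(\<lambda>N. \<Sum>i\<in>J N. g N i * fps_X ^ e i) \<longlonglongrightarrow> fps_series I e G"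
proof (rule tendsto_fpsI)
  fix k
  have "eventually (\<lambda>N. \<forall>i\<in>{i\<in>I. e i \<le> k}. i \<in> J N \<and> fps_nth (g N i) (k - e i) =
      fps_nth (G i) (k - e i)) sequentially"
    using lf g J(3) by (subst eventually_ball_finite_distrib)
      (auto simp: locally_finite_def tendsto_fps_iff intro: eventually_conj)
  thus "eventually (\<lambda>N. fps_nth (\<Sum>i\<in>J N. g N i * fps_X ^ e i) k = fps_nth (fps_series I e G) k)
      sequentially"
  proof eventually_elim
    case (elim N)
    have "fps_nth (\<Sum>i\<in>J N. g N i * fps_X ^ e i) k = fps_nth (fps_series I e (g N)) k"
      using elim J by (intro fps_series_nth_eq [symmetric]) auto
    also have "\<dots> = fps_nth (fps_series I e G) k"
      using elim by (auto simp: fps_series_def intro!: sum.cong)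
    finally show ?case .
  qed
qed

lemma fps_series_cong:
  assumes "\<And>i. i \<in> I \<Longrightarrow> e i = e' i" "\<And>i. i \<in> I \<Longrightarrow> G i = G' i"
  shows "fps_series I e G = fps_series I e' G'"
proof -
  have "{i\<in>I. e i \<le> k} = {i\<in>I. e' i \<le> k}" for k using assms by auto
  thus ?thesis unfolding fps_series_def using assms
    by (intro arg_cong[of _ _ Abs_fps] ext sum.cong) auto
qed

lemma fps_series_cmult:
  assumes "locally_finite I e"
  shows "fps_series I e (\<lambda>i. c * G i) = c * fps_series I e G"
proof (rule fps_ext)
  fix k
  have "fps_nth (c * fps_series I e G) k = fps_nth (c * (\<Sum>i\<in>{i\<in>I. e i \<le> k}. G i * fps_X ^ e i)) k"
    by (rule fps_mult_nth_cong) (use fps_series_nth[OF assms] in auto)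
  also have "\<dots> = fps_nth (fps_series I e (\<lambda>i. c * G i)) k"
    by (subst fps_series_nth[OF assms order_refl]) (simp add: sum_distrib_left mult.assoc)
  finally show "fps_nth (fps_series I e (\<lambda>i. c * G i)) k = fps_nth (c * fps_series I e G) k" ..
qed

lemma locally_finite_times:
  assumes "locally_finite I e" "locally_finite J f"
  shows "locally_finite (I \<times> J) (\<lambda>(i, j). e i + f j)"
  unfolding locally_finite_def
proof
  fix k
  have "{p \<in> I \<times> J. (case p of (i, j) \<Rightarrow> e i + f j) \<le> k} \<subseteq> {i\<in>I. e i \<le> k} \<times> {j\<in>J. f j \<le> k}"
    by auto
  thus "finite {p \<in> I \<times> J. (case p of (i, j) \<Rightarrow> e i + f j) \<le> k}"
    by (rule finite_subset) (use assms in \<open>simp add: locally_finite_def\<close>)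
qed

lemma fps_series_mult:
  assumes "locally_finite I e" "locally_finite J f"
  shows "fps_series I e G * fps_series J f H =
      fps_series (I \<times> J) (\<lambda>(i, j). e i + f j) (\<lambda>(i, j). G i * H j)"
proof (rule fps_ext)
  fix k
  let ?I = "{i\<in>I. e i \<le> k}" and ?J = "{j\<in>J. f j \<le> k}"
  have "fps_nth (fps_series I e G * fps_series J f H) k =
        fps_nth ((\<Sum>i\<in>?I. G i * fps_X ^ e i) * (\<Sum>j\<in>?J. H j * fps_X ^ f j)) k"
    by (rule fps_mult_nth_cong) (use fps_series_nth[OF assms(1)] fps_series_nth[OF assms(2)] in
        auto)
  also have "(\<Sum>i\<in>?I. G i * fps_X ^ e i) * (\<Sum>j\<in>?J. H j * fps_X ^ f j) =
     (\<Sum>p\<in>?I\<times>?J. (\<lambda>(i, j). G i * H j) p * fps_X ^ (\<lambda>(i, j). e i + f j) p)"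
    unfolding sum_product sum.cartesian_product
    by (intro sum.cong refl) (auto simp: power_add mult_ac)
  also have "fps_nth \<dots> k = fps_nth (fps_series (I \<times> J) (\<lambda>(i, j). e i + f j) (\<lambda>(i, j). G i * H j)) k"
    using assms by (intro fps_series_nth_eq[OF _ _ _ order_refl, symmetric])
        (auto simp: locally_finite_def)
  finally show "fps_nth (fps_series I e G * fps_series J f H) k =
      fps_nth (fps_series (I \<times> J) (\<lambda>(i, j). e i + f j) (\<lambda>(i, j). G i * H j)) k" .
qed

lemma fps_series_reindex:
  assumes "bij_betw h J I"
  shows "fps_series I e G = fps_series J (\<lambda>j. e (h j)) (\<lambda>j. G (h j))"
proof (rule fps_ext)
  fix k
  have "bij_betw h {j\<in>J. e (h j) \<le> k} {i\<in>I. e i \<le> k}"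
    using assms by (auto simp: bij_betw_def inj_on_def)
  thus "fps_nth (fps_series I e G) k = fps_nth (fps_series J (\<lambda>j. e (h j)) (\<lambda>j. G (h j))) k"
    using sum.reindex_bij_betw[of h _ _ "\<lambda>i. fps_nth (G i) (k - e i)"] by (simp add: fps_series_def)
qed

lemma fps_series_union_disjoint:
  assumes "locally_finite (I \<union> J) e" "I \<inter> J = {}"
  shows "fps_series (I \<union> J) e G = fps_series I e G + fps_series J e G"
proof (rule fps_ext)
  fix k
  have fin: "finite {i\<in>I. e i \<le> k}" "finite {i\<in>J. e i \<le> k}"
    by (rule finite_subset[of _ "{i \<in> I \<union> J. e i \<le> k}"];
        use assms(1) in \<open>force simp: locally_finite_def\<close>)+
  have "{i \<in> I \<union> J. e i \<le> k} = {i\<in>I. e i \<le> k} \<union> {i\<in>J. e i \<le> k}" by auto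
  thus "fps_nth (fps_series (I \<union> J) e G) k = fps_nth (fps_series I e G + fps_series J e G) k"
    using fin assms(2) by (simp add: fps_series_def sum.union_disjoint disjoint_iff)
qed

lemma fps_series_zero: "(\<And>i. i \<in> I \<Longrightarrow> G i = 0) \<Longrightarrow> fps_series I e G = 0"
  by (rule fps_ext) (auto simp: fps_series_def intro!: sum.neutral)

section \<open>The limit of the Bailey identity\<close>

text \<open>The infinite product of all \<open>1 - X ^ (b * i)\<close>: coefficient \<open>k\<close> no longer changes after the
first \<open>k\<close> factors.\<close>

definition qfac_inf :: "nat \<Rightarrow> complex fps" where
  "qfac_inf b = Abs_fps (\<lambda>k. fps_nth (qfac (fps_X ^ b) k) k)"

lemma qfac_nth_stable:
  assumes "b > 0" "k \<le> m"
  shows "fps_nth (qfac (fps_X ^ b :: complex fps) m) k = fps_nth (qfac (fps_X ^ b) k) k"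
  using assms(2)
proof (induction m rule: dec_induct)
  case (step m)
  have "k < b * Suc m" using step assms(1) by (cases b) auto
  hence "fps_nth (qfac (fps_X ^ b) m * (fps_X ^ b :: complex fps) ^ Suc m) k = 0"
    by (simp add: fps_X_power_mult_right_nth del: power_Suc flip: power_mult)
  thus ?case using step.IH by (simp only: qfac_Suc right_diff_distrib fps_sub_nth mult_1_right) simp
qed auto

lemma qfac_tendsto:
  assumes "b > 0" "filterlim f at_top F"
  shows "((\<lambda>n. qfac (fps_X ^ b) (f n)) \<longlongrightarrow> qfac_inf b) F"
proof (rule tendsto_fpsI)
  fix k
  have "eventually (\<lambda>n. k \<le> f n) F"
    using assms(2) by (simp add: filterlim_at_top)
  thus "eventually (\<lambda>n. fps_nth (qfac (fps_X ^ b) (f n)) k = fps_nth (qfac_inf b) k) F"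
  proof eventually_elim
    case (elim n)
    show ?case using qfac_nth_stable[OF assms(1) elim] by (simp add: qfac_inf_def)
  qed
qed

lemma qfac_inf_nth_0: "b > 0 \<Longrightarrow> fps_nth (qfac_inf b) 0 = 1"
  by (simp add: qfac_inf_def)

lemma qfac_inf_mult_inverse: "b > 0 \<Longrightarrow> qfac_inf b * inverse (qfac_inf b) = 1"
  using qfac_inf_nth_0[of b] by (intro inverse_mult_eq_1') auto

lemma inverse_qfac_tendsto:
  assumes "b > 0" "filterlim f at_top F"
  shows "((\<lambda>n. inverse (qfac (fps_X ^ b) (f n))) \<longlongrightarrow> inverse (qfac_inf b)) F"
  using qfac_tendsto[OF assms] qfac_inf_nth_0[OF assms(1)] by (intro tendsto_inverse_fps) auto

lemma inv_qfac_tendsto: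
  assumes "filterlim f at_top F"
  shows "((\<lambda>n. inv_qfac (f n)) \<longlongrightarrow> inverse (qfac_inf 1)) F"
  using inverse_qfac_tendsto[OF _ assms, of 1] by (simp add: inv_qfac_def)

lemma filterlim_nat_shift: "filterlim (\<lambda>N. nat (int N + r)) at_top sequentially"
proof (unfold filterlim_at_top, intro allI)
  fix Z
  show "eventually (\<lambda>N. Z \<le> nat (int N + r)) sequentially"
    by (rule eventually_sequentiallyI[of "Z + nat \<bar>r\<bar>"]) linarith
qed

lemma eventually_in_symmetric_interval: "eventually (\<lambda>N. r \<in> {-int N..int N}) sequentially"
  by (rule eventually_sequentiallyI[of "nat \<bar>r\<bar>"]) auto

definition bailey_theta :: "complex fps" where
  "bailey_theta = fps_series UNIV bailey_exp (\<lambda>r. fps_const (chi3 r))"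

lemma finite_abs_le: "finite {r::int. \<bar>r\<bar> \<le> c}"
  by (rule finite_subset[of _ "{-c..c}"]) auto

lemma locally_finite_int:
  assumes "\<And>r::int. r \<in> I \<Longrightarrow> \<bar>r\<bar> \<le> int (e r)"
  shows "locally_finite I e"
  unfolding locally_finite_def
proof
  fix k
  show "finite {i \<in> I. e i \<le> k}"
    by (rule finite_subset[OF _ finite_abs_le[of "int k"]]) (use assms in force)
qed

lemma abs_le_square_int: "\<bar>r::int\<bar> \<le> r^2"
  using self_le_power[of "\<bar>r\<bar>" 2] by (cases "r = 0") auto

lemma locally_finite_bailey_exp: "locally_finite UNIV bailey_exp"
  by (rule locally_finite_int) (use abs_le_square_int in \<open>simp add: bailey_exp_def add_increasing\<close>)

lemma locally_finite_squares: "locally_finite UNIV (\<lambda>n::nat. n^2)"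
  unfolding locally_finite_def
proof
  fix k :: nat
  have "{i. i^2 \<le> k} \<subseteq> {..k}"
    using power2_nat_le_imp_le by auto
  thus "finite {i \<in> UNIV. i^2 \<le> k}" by (simp add: finite_subset)
qed

text \<open>In the limit of the finite identity the left side acquires one and the right side two
factors \<open>1 / qfac_inf 1\<close>.\<close>

theorem bailey_identity: "fps_series UNIV (\<lambda>n. n^2) bailey_beta * qfac_inf 1 = bailey_theta"
proof -
  let ?q = "inverse (qfac_inf 1)"
  have L: "(\<lambda>N. \<Sum>n\<le>N. inv_qfac (N - n) * bailey_beta n * fps_X ^ (n^2)) \<longlonglongrightarrow>
      fps_series UNIV (\<lambda>n. n^2) (\<lambda>n. ?q * bailey_beta n)"
  proof (rule fps_series_tendsto)
    fix n :: nat
    have "filterlim (\<lambda>N. N - n) at_top sequentially"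
      by (rule filterlim_minus_const_nat_at_top)
    thus "(\<lambda>N. inv_qfac (N - n) * bailey_beta n) \<longlonglongrightarrow> ?q * bailey_beta n"
      by (intro tendsto_mult_fps inv_qfac_tendsto tendsto_const)
  qed (auto simp: locally_finite_squares intro: eventually_ge_at_top)
  have R: "(\<lambda>N. \<Sum>r=-int N..int N. fps_const (chi3 r) *
      (inv_qfac (nat (int N - r)) * inv_qfac (nat (int N + r))) *
       fps_X ^ bailey_exp r) \<longlonglongrightarrow> fps_series UNIV bailey_exp (\<lambda>r. fps_const (chi3 r) * (?q * ?q))"
  proof (rule fps_series_tendsto)
    fix r :: int
    show "(\<lambda>N. fps_const (chi3 r) * (inv_qfac (nat (int N - r)) * inv_qfac (nat (int N + r)))) \<longlonglongrightarrow>
        fps_const (chi3 r) * (?q * ?q)"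
      using filterlim_nat_shift[of r] filterlim_nat_shift[of "-r"]
      by (intro tendsto_mult_fps inv_qfac_tendsto tendsto_const) simp_all
  qed (use locally_finite_bailey_exp eventually_in_symmetric_interval in auto)
  have "fps_series UNIV (\<lambda>n. n^2) (\<lambda>n. ?q * bailey_beta n) =
        fps_series UNIV bailey_exp (\<lambda>r. fps_const (chi3 r) * (?q * ?q))"
    by (rule LIMSEQ_unique[OF L[unfolded finite_bailey_identity] R])
  also have "\<dots> = fps_series UNIV bailey_exp (\<lambda>r. (?q * ?q) * fps_const (chi3 r))"
    by (simp only: mult.commute[of "fps_const _"])
  finally have "fps_series UNIV (\<lambda>n. n^2) (\<lambda>n. ?q * bailey_beta n) = \<dots>" .
  hence "?q * fps_series UNIV (\<lambda>n. n^2) bailey_beta = ?q * ?q * bailey_theta"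
    by (simp only: bailey_theta_def fps_series_cmult[OF locally_finite_squares]
        fps_series_cmult[OF locally_finite_bailey_exp])
  hence "(qfac_inf 1 * ?q) * (fps_series UNIV (\<lambda>n. n^2) bailey_beta * qfac_inf 1) =
      (qfac_inf 1 * ?q) * (qfac_inf 1 * ?q) * bailey_theta"
    by (simp only: mult_ac)
  thus ?thesis by (simp only: qfac_inf_mult_inverse zero_less_one mult_1_left)
qed

section \<open>The Jacobi triple product\<close>

definition theta_exp :: "nat \<Rightarrow> nat \<Rightarrow> int \<Rightarrow> nat" where
  "theta_exp b a r = nat (int b * int (tri r) + int a * r)"

text \<open>The series of all \<open>s ^ r * X ^ (b * r * (r - 1) / 2 + a * r)\<close>. It is used only for \<open>s = 1\<close>
and \<open>s = -1\<close>, where \<open>s ^ r = s ^ \<bar>r\<bar>\<close>.\<close>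

definition theta :: "nat \<Rightarrow> nat \<Rightarrow> complex \<Rightarrow> complex fps" where
  "theta b a s = fps_series UNIV (theta_exp b a) (\<lambda>r. fps_const (s ^ nat \<bar>r\<bar>))"

text \<open>The bound yields both the non-negativity of the exponent, so that \<open>nat\<close> in \<open>theta_exp\<close>
does no harm, and local finiteness.\<close>

lemma theta_exp_ge:
  assumes "0 < a" "a < b"
  shows "\<bar>r\<bar> \<le> int b * int (tri r) + int a * r"
proof (cases "r \<ge> 0")
  case True
  have "1 * r \<le> int a * r" using assms True by (intro mult_right_mono) auto
  thus ?thesis using True by (simp add: add_increasing)
next
  case False
  have "- r * 1 \<le> - r * (- r)" using False by (intro mult_left_mono) auto
  hence tr: "- r \<le> int (tri r)" using tri_eq[of r] by (simp add: algebra_simps)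
  have "- r \<le> int (b - a) * (- r)" using assms False mult_right_mono[of 1 "int (b - a)" "-r"]
    by simp
  also have "\<dots> = int b * (- r) + int a * r" using assms by (simp add: of_nat_diff algebra_simps)
  also have "\<dots> \<le> int b * int (tri r) + int a * r" using tr by (intro add_mono mult_left_mono) auto
  finally show ?thesis using False by simp
qed

lemma theta_exp_eq:
  assumes "0 < a" "a < b"
  shows "2 * int (theta_exp b a r) = int b * (r * (r - 1)) + 2 * int a * r"
proof -
  have "int (theta_exp b a r) = int b * int (tri r) + int a * r"
    using theta_exp_ge[OF assms, of r] by (simp add: theta_exp_def)
  hence "2 * int (theta_exp b a r) = int b * (2 * int (tri r)) + 2 * int a * r"
    by (simp add: algebra_simps)
  thus ?thesis unfolding tri_eq .
qed

lemma locally_finite_theta: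
  assumes "0 < a" "a < b"
  shows "locally_finite UNIV (theta_exp b a)"
  by (rule locally_finite_int, rule order_trans[OF theta_exp_ge[OF assms]])
      (simp add: theta_exp_def)

text \<open>The finite triple product with \<open>q = X ^ b\<close> and \<open>z = s * X ^ a\<close>, divided by \<open>z ^ n\<close>.\<close>

lemma finite_theta:
  fixes s :: complex
  assumes ab: "0 < a" "a < b" and s: "s * s = 1"
  shows "(\<Prod>i=1..n. (1 + fps_const s * fps_X ^ (b * i - a)) *
      (1 + fps_const s * fps_X ^ (b * (i - 1) + a))) =
         (\<Sum>r=-int n..int n. qbin (fps_X ^ b) (2 * n) (nat (int n + r)) * fps_const (s ^ nat \<bar>r\<bar>) *
             fps_X ^ theta_exp b a r)"
    (is "?L = ?R")
proof -
  let ?X = "fps_X :: complex fps" and ?s = "fps_const s"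
  define z where "z = ?s * ?X ^ a"
  have ss: "?s * ?s = 1" using s by (simp only: fps_const_mult fps_const_1_eq_1)
  have "?s ^ n * ?X ^ (a * n) * ?L = (\<Prod>i=1..n. z + (?X ^ b) ^ i) * (\<Prod>i<n. 1 + z * (?X ^ b) ^ i)"
  proof -
    have "(\<Prod>i=1..n. z + (?X ^ b) ^ i) = (\<Prod>i=1..n. z * (1 + ?s * ?X ^ (b * i - a)))"
    proof (intro prod.cong refl)
      fix i assume "i \<in> {1..n}"
      hence "b * 1 \<le> b * i" by (intro mult_left_mono) auto
      hence "a + (b * i - a) = b * i" using ab unfolding mult_1_right by linarith
      hence "?X ^ a * ?X ^ (b * i - a) = (?X ^ b) ^ i"
        by (simp only: flip: power_add power_mult)
      moreover have "z * (1 + ?s * ?X ^ (b * i - a)) = z + (?s * ?s) * (?X ^ a * ?X ^ (b * i - a))"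
        unfolding z_def by (simp only: distrib_left mult_1_right mult_1_left mult_ac)
      ultimately show "z + (?X ^ b) ^ i = z * (1 + ?s * ?X ^ (b * i - a))"
        by (simp only: ss mult_1_left)
    qed
    also have "\<dots> = z ^ n * (\<Prod>i=1..n. 1 + ?s * ?X ^ (b * i - a))"
      by (simp add: prod.distrib)
    also have "z ^ n = ?s ^ n * ?X ^ (a * n)"
      by (simp only: z_def power_mult_distrib power_mult)
    finally have 1: "(\<Prod>i=1..n. z + (?X ^ b) ^ i) = \<dots> * (\<Prod>i=1..n. 1 + ?s * ?X ^ (b * i - a))" .
    have 2: "(\<Prod>i<n. 1 + z * (?X ^ b) ^ i) = (\<Prod>i=1..n. 1 + ?s * ?X ^ (b * (i - 1) + a))"
      by (rule prod.reindex_bij_witness[of _ "\<lambda>i. i - 1" Suc])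
         (auto simp: z_def power_add mult_ac simp flip: power_mult)
    show ?thesis unfolding 1 2 prod.distrib by (simp only: mult_ac)
  qed
  also have "\<dots> = (\<Sum>k\<le>2*n. qbin (?X ^ b) (2*n) k * (?X ^ b) ^ tri (int k - int n) * z ^ k)"
    by (rule finite_jacobi_triple) simp
  also have "\<dots> = (\<Sum>r=-int n..int n. qbin (?X ^ b) (2*n) (nat (int n + r)) * (?X ^ b) ^ tri r *
      z ^ (nat (int n + r)))"
    by (rule sum.reindex_bij_witness[of _ "\<lambda>r. nat (int n + r)" "\<lambda>k. int k - int n"]) auto
  also have "\<dots> = ?s ^ n * ?X ^ (a * n) * ?R"
    unfolding sum_distrib_left
  proof (intro sum.cong refl)
    fix r assume r: "r \<in> {-int n..int n}"
    have "int (b * tri r + a * nat (int n + r)) = int (a * n + theta_exp b a r)"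
      using r theta_exp_ge[OF ab, of r] by (simp add: theta_exp_def algebra_simps)
    hence e: "b * tri r + a * nat (int n + r) = a * n + theta_exp b a r"
      by (simp only: of_nat_eq_iff)
    have X: "(?X ^ b) ^ tri r * (?X ^ a) ^ nat (int n + r) = ?X ^ (a * n) * ?X ^ theta_exp b a r"
      by (simp only: e flip: power_mult power_add)
    have S: "?s ^ nat (int n + r) = ?s ^ n * ?s ^ nat \<bar>r\<bar>"
    proof (cases "r \<ge> 0")
      case True
      thus ?thesis by (simp add: nat_add_distrib power_add)
    next
      case False
      define m k where "m = nat (int n + r)" and "k = nat \<bar>r\<bar>"
      have n: "n = m + k" using False r by (simp add: m_def k_def)
      have "?s ^ n * ?s ^ k = ?s ^ m * (?s * ?s) ^ k"
        by (simp only: n power_add power_mult_distrib mult_ac)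
      thus ?thesis by (simp only: ss power_one mult_1_right m_def k_def)
    qed
    have "qbin (?X ^ b) (2*n) (nat (int n + r)) * (?X ^ b) ^ tri r * z ^ (nat (int n + r)) =
          qbin (?X ^ b) (2*n) (nat (int n + r)) *
              ((?X ^ b) ^ tri r * (?X ^ a) ^ nat (int n + r)) * ?s ^ nat (int n + r)"
      by (simp only: z_def power_mult_distrib mult_ac)
    also have "\<dots> = ?s ^ n * ?X ^ (a * n) * (qbin (?X ^ b) (2*n) (nat (int n + r)) * ?s ^ nat \<bar>r\<bar> *
        ?X ^ theta_exp b a r)"
      unfolding X S by (simp only: mult_ac)
    finally show "qbin (?X ^ b) (2*n) (nat (int n + r)) * (?X ^ b) ^ tri r * z ^ (nat (int n + r)) =
          ?s ^ n * ?X ^ (a * n) * (qbin (?X ^ b) (2*n) (nat (int n + r)) *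
              fps_const (s ^ nat \<bar>r\<bar>) * ?X ^ theta_exp b a r)"
      unfolding fps_const_power .
  qed
  finally have "?s ^ n * ?X ^ (a * n) * ?L = ?s ^ n * ?X ^ (a * n) * ?R" .
  moreover have "s \<noteq> 0" using s by auto
  hence "?s ^ n * ?X ^ (a * n) \<noteq> 0" by (simp only: mult_eq_0_iff power_eq_0_iff fps_const_eq_0_iff
      fps_X_neq_zero) simp
  ultimately show ?thesis by (simp only: mult_cancel_left simp_thms)
qed

text \<open>In the finite version the Gaussian coefficient of \<open>2 * n\<close> over \<open>n + r\<close> tends to
\<open>1 / qfac_inf b\<close> for each \<open>r\<close>, which the factor \<open>qfac (X ^ b) n\<close> compensates.\<close>

theorem jacobi_triple_product:
  fixes s :: complex
  assumes ab: "0 < a" "a < b" and s: "s * s = 1"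
  shows "(\<lambda>n. qfac (fps_X ^ b) n *
           (\<Prod>i=1..n. (1 + fps_const s * fps_X ^ (b * i - a)) *
               (1 + fps_const s * fps_X ^ (b * (i - 1) + a))))
         \<longlonglongrightarrow> theta b a s"
proof -
  let ?Q = "qfac (fps_X ^ b :: complex fps)"
  have b: "b > 0" using ab by simp
  have "(\<lambda>n. \<Sum>r=-int n..int n. ?Q n * qbin (fps_X ^ b) (2 * n) (nat (int n + r)) *
      fps_const (s ^ nat \<bar>r\<bar>) * fps_X ^ theta_exp b a r)
    \<longlonglongrightarrow> theta b a s"
    unfolding theta_def
  proof (rule fps_series_tendsto)
    fix r :: int
    have "(\<lambda>n. ?Q n * (?Q (2 * n) * (inverse (?Q (nat (int n + r))) *
        inverse (?Q (nat (int n + (-r)))))) * fps_const (s ^ nat \<bar>r\<bar>))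
      \<longlonglongrightarrow> qfac_inf b * (qfac_inf b * (inverse (qfac_inf b) * inverse (qfac_inf b))) *
          fps_const (s ^ nat \<bar>r\<bar>)"
      using b by (intro tendsto_mult_fps qfac_tendsto inverse_qfac_tendsto filterlim_nat_shift
          tendsto_const
          filterlim_ident mult_nat_left_at_top) auto
    also have "qfac_inf b * (qfac_inf b * (inverse (qfac_inf b) * inverse (qfac_inf b))) =
          (qfac_inf b * inverse (qfac_inf b)) *
              (qfac_inf b * inverse (qfac_inf b))" by (simp only: mult_ac)
    also have "\<dots> = 1" by (simp only: qfac_inf_mult_inverse[OF b] mult_1_left)
    finally have L: "(\<lambda>n. ?Q n * (?Q (2 * n) *
        (inverse (?Q (nat (int n + r))) * inverse (?Q (nat (int n + (-r)))))) *
        fps_const (s ^ nat \<bar>r\<bar>))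
      \<longlonglongrightarrow> fps_const (s ^ nat \<bar>r\<bar>)"
      by (simp only: mult_1_left)
    have "eventually (\<lambda>n. ?Q n * (?Q (2 * n) *
        (inverse (?Q (nat (int n + r))) * inverse (?Q (nat (int n + (-r)))))) *
        fps_const (s ^ nat \<bar>r\<bar>) =
             ?Q n * qbin (fps_X ^ b) (2 * n) (nat (int n + r)) * fps_const (s ^ nat \<bar>r\<bar>))
                 sequentially"
      using eventually_in_symmetric_interval[of r]
    proof eventually_elim
      case (elim n)
      define k j where "k = nat (int n + r)" and "j = nat (int n + (- r))"
      have kj: "k \<le> 2 * n" "2 * n - k = j" using elim by (auto simp: k_def j_def)
      have inv: "?Q m * inverse (?Q m) = 1" for m
        using qfac_nth_0[OF b, of m] by (intro inverse_mult_eq_1') auto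
      have "?Q (2 * n) * (inverse (?Q k) * inverse (?Q j)) =
            qbin (fps_X ^ b) (2 * n) k * ((?Q k * inverse (?Q k)) * (?Q j * inverse (?Q j)))"
        unfolding qbin_mult_qfac[OF kj(1), of "fps_X ^ b", symmetric] kj(2) by (simp only: mult_ac)
      hence "?Q (2 * n) * (inverse (?Q k) * inverse (?Q j)) = qbin (fps_X ^ b) (2 * n) k"
        by (simp only: inv mult_1_right)
      thus ?case unfolding k_def j_def by (simp only:)
    qed
    from Lim_transform_eventually[OF L this]
    show "(\<lambda>n. ?Q n * qbin (fps_X ^ b) (2 * n) (nat (int n + r)) * fps_const (s ^ nat \<bar>r\<bar>)) \<longlonglongrightarrow>
        fps_const (s ^ nat \<bar>r\<bar>)" .
  qed (use locally_finite_theta[OF ab] eventually_in_symmetric_interval in auto)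
  thus ?thesis
    unfolding finite_theta[OF assms] sum_distrib_left by (simp only: mult.assoc)
qed

section \<open>The quintuple product\<close>

lemma locally_finite_subset: "locally_finite I e \<Longrightarrow> J \<subseteq> I \<Longrightarrow> locally_finite J e"
  unfolding locally_finite_def by (blast intro:
      finite_subset[of "{i \<in> J. e i \<le> _}" "{i \<in> I. e i \<le> _}"])

lemma fps_series_split:
  assumes "locally_finite UNIV e"
  shows "fps_series UNIV e G = fps_series {i. P i} e G + fps_series {i. \<not> P i} e G"
proof -
  have "UNIV = {i. P i} \<union> {i. \<not> P i}" by auto
  thus ?thesis using fps_series_union_disjoint[of "{i. P i}" "{i. \<not> P i}" e G] assms by auto
qed

lemma bailey_exp_eq: "2 * int (bailey_exp r) = r * (3 * r - 1)"
  using tri_eq[of r] by (simp add: bailey_exp_def algebra_simps power2_eq_square)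

lemma locally_finite_inj:
  assumes "locally_finite UNIV e" "inj h"
  shows "locally_finite UNIV (\<lambda>i. e (h i))"
  unfolding locally_finite_def
proof
  fix k
  have "finite (h -` {i. e i \<le> k})"
    using assms by (intro finite_vimageI) (auto simp: locally_finite_def)
  thus "finite {i \<in> UNIV. e (h i) \<le> k}" by (simp add: vimage_def)
qed

text \<open>The terms with \<open>r = 1 (mod 3)\<close> vanish; the remaining two classes are parametrised by
\<open>r = -3 * n\<close> and \<open>r = -3 * n - 1\<close>, as in the usual bilateral form of the quintuple product.\<close>

lemma bailey_theta_split:
  "bailey_theta = fps_series UNIV (\<lambda>n. bailey_exp (-3 * n)) (\<lambda>_. 1) -
      fps_series UNIV (\<lambda>n. bailey_exp (-3 * n - 1)) (\<lambda>_. 1)"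
proof -
  let ?c = "\<lambda>r. fps_const (chi3 r)"
  have "bailey_theta = fps_series {r. r mod 3 = 0} bailey_exp ?c +
      fps_series {r. r mod 3 \<noteq> 0} bailey_exp ?c"
    using fps_series_split[OF locally_finite_bailey_exp, of ?c "\<lambda>r. r mod 3 = 0"]
    by (simp add: bailey_theta_def)
  also have "{r::int. r mod 3 \<noteq> 0} = {r. r mod 3 = 2} \<union> {r. r mod 3 = 1}" by auto
  also have "fps_series \<dots> bailey_exp ?c = fps_series {r. r mod 3 = 2} bailey_exp ?c +
      fps_series {r. r mod 3 = 1} bailey_exp ?c"
    by (rule fps_series_union_disjoint) (auto intro:
        locally_finite_subset[OF locally_finite_bailey_exp])
  also have "fps_series {r. r mod 3 = 1} bailey_exp ?c = 0"
    by (rule fps_series_zero) (simp add: chi3_def)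
  also have "fps_series {r. r mod 3 = 0} bailey_exp ?c =
      fps_series UNIV (\<lambda>n. bailey_exp (-3 * n)) (\<lambda>n. ?c (-3 * n))"
    by (rule fps_series_reindex, rule bij_betw_byWitness[where f' = "\<lambda>r. - (r div 3)"]) auto
  also have "\<dots> = fps_series UNIV (\<lambda>n. bailey_exp (-3 * n)) (\<lambda>_. 1)"
    by (rule fps_series_cong) (auto simp: chi3_def)
  also have "fps_series {r. r mod 3 = 2} bailey_exp ?c =
      fps_series UNIV (\<lambda>n. bailey_exp (-3 * n - 1)) (\<lambda>n. ?c (-3 * n - 1))"
    by (rule fps_series_reindex, rule bij_betw_byWitness[where f' = "\<lambda>r. - ((r + 1) div 3)"])
        (auto, presburger+)
  also have "\<dots> = fps_series UNIV (\<lambda>n. bailey_exp (-3 * n - 1)) (\<lambda>_. - 1 * 1)"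
  proof (rule fps_series_cong)
    fix n :: int
    have "(-3 * n - 1) mod 3 = 2" by presburger
    thus "?c (-3 * n - 1) = - 1 * 1" by (simp add: chi3_def flip: fps_const_neg)
  qed auto
  also have "\<dots> = - 1 * fps_series UNIV (\<lambda>n. bailey_exp (-3 * n - 1)) (\<lambda>_. 1)"
    by (rule fps_series_cmult, rule locally_finite_inj[OF locally_finite_bailey_exp])
        (auto simp: inj_def)
  finally show ?thesis by simp
qed

text \<open>Put \<open>w = X ^ 9\<close> and \<open>z = X ^ 2\<close>. The product on the left is a double series in \<open>(n, m)\<close>,
whose terms carry the power \<open>z ^ (3 * n + m)\<close> if they come from the first part of \<open>bailey_theta\<close>
and \<open>z ^ (3 * n + 1 + m)\<close> if they come from the second, negative part. Terms with an odd power
of \<open>z\<close> cancel in pairs: for the power \<open>2 * k + 1\<close>, the index \<open>n\<close> in one part corresponds to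
\<open>k - n\<close> in the other. For an even power \<open>z ^ (2 * k)\<close> the \<open>w\<close>-exponent is
\<open>j * (3 * j - 1) / 2 + k * (k - 1) / 2\<close> with \<open>j = k - 2 * n\<close> in the first and
\<open>j = 2 * n + 1 - k\<close> in the second part. The parity of \<open>j + k\<close> tells the two parts apart and is
also the sign of the term on the right.\<close>

theorem quintuple_times_triple: "bailey_theta * theta 9 2 1 = theta 27 9 (-1) * theta 9 4 (-1)"
proof -
  define e1 where "e1 = (\<lambda>(n, m). bailey_exp (-3 * n) + theta_exp 9 2 m)"
  define e2 where "e2 = (\<lambda>(n, m). bailey_exp (-3 * n - 1) + theta_exp 9 2 m)"
  define w where "w = (\<lambda>(j, k). theta_exp 27 9 j + theta_exp 9 4 k)"
  define Ev Od :: "(int \<times> int) set" where "Ev = {p. even (fst p + snd p)}" and "Od =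
      {p. odd (fst p + snd p)}"
  let ?one = "\<lambda>_. 1 :: complex fps"
  have t92: "2 * int (theta_exp 9 2 r) = 9 * (r * (r - 1)) + 4 * r" for r
    by (simp add: theta_exp_eq)
  have t94: "2 * int (theta_exp 9 4 r) = 9 * (r * (r - 1)) + 8 * r" for r
    by (simp add: theta_exp_eq)
  have t279: "2 * int (theta_exp 27 9 r) = 27 * (r * (r - 1)) + 18 * r" for r
    by (simp add: theta_exp_eq)
  have lf1: "locally_finite UNIV e1" unfolding e1_def UNIV_Times_UNIV[symmetric]
    by (intro locally_finite_times locally_finite_theta
        locally_finite_inj[OF locally_finite_bailey_exp]) (auto simp: inj_def)
  have lf2: "locally_finite UNIV e2" unfolding e2_def UNIV_Times_UNIV[symmetric]
    by (intro locally_finite_times locally_finite_theta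
        locally_finite_inj[OF locally_finite_bailey_exp]) (auto simp: inj_def)
  have lfw: "locally_finite UNIV w" unfolding w_def UNIV_Times_UNIV[symmetric]
    by (intro locally_finite_times locally_finite_theta) auto
  have split: "fps_series UNIV e G = fps_series Ev e G +
      fps_series Od e G" if "locally_finite UNIV e" for e G
    unfolding Ev_def Od_def by (rule fps_series_split[OF that])

  have "fps_series UNIV (\<lambda>n. bailey_exp (-3 * n)) ?one * theta 9 2 1 = fps_series UNIV e1 ?one"
    unfolding theta_def
    by (subst fps_series_mult)
       (auto simp: e1_def inj_def locally_finite_theta intro!:
           locally_finite_inj[OF locally_finite_bailey_exp] fps_series_cong)
  moreover have "fps_series UNIV (\<lambda>n. bailey_exp (-3 * n - 1)) ?one * theta 9 2 1 =
      fps_series UNIV e2 ?one"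
    unfolding theta_def
    by (subst fps_series_mult)
       (auto simp: e2_def inj_def locally_finite_theta intro!:
           locally_finite_inj[OF locally_finite_bailey_exp] fps_series_cong)
  ultimately have "bailey_theta * theta 9 2 1 = fps_series UNIV e1 ?one - fps_series UNIV e2 ?one"
    unfolding bailey_theta_split by (simp only: left_diff_distrib)
  also have "\<dots> = fps_series Ev e1 ?one + fps_series Od e1 ?one -
      (fps_series Ev e2 ?one + fps_series Od e2 ?one)"
    by (simp only: split[OF lf1] split[OF lf2])
  also have "fps_series Od e1 ?one = fps_series Ev e2 ?one"
  proof -
    define h :: "int \<times> int \<Rightarrow> int \<times> int" where
      "h = (\<lambda>(n, m). let k = (3 * n + m) div 2 in (k - n, 2 * k + 1 - 3 * (k - n)))"
    have "bij_betw h Ev Od"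
      by (rule bij_betw_byWitness[where f' = "\<lambda>(n, m). let k =
          (3 * n + m - 1) div 2 in (k - n, 2 * k - 3 * (k - n))"])
         (auto simp: h_def Let_def Ev_def Od_def; presburger)+
    hence "fps_series Od e1 ?one = fps_series Ev (\<lambda>p. e1 (h p)) ?one" by (rule fps_series_reindex)
    also have "\<dots> = fps_series Ev e2 ?one"
    proof (rule fps_series_cong[OF _ refl])
      fix p assume "p \<in> Ev"
      then obtain n m where p: "p = (n, m)" "even (n + m)" by (cases p) (auto simp: Ev_def)
      hence "even (3 * n + m)" by simp
      then obtain k where k: "3 * n + m = 2 * k" by (elim evenE)
      have h: "h p = (k - n, 2 * k + 1 - 3 * (k - n))" using k by (simp add: p h_def)
      have m: "m = 2 * k - 3 * n" using k by simp
      have "2 * int (e1 (h p)) = 2 * int (bailey_exp (- 3 * (k - n))) + 2 *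
          int (theta_exp 9 2 (2 * k + 1 - 3 * (k - n)))"
        unfolding h e1_def by simp
      also have "\<dots> = 2 * int (bailey_exp (- 3 * n - 1)) + 2 * int (theta_exp 9 2 m)"
        unfolding bailey_exp_eq t92 m by (simp add: algebra_simps)
      also have "\<dots> = 2 * int (e2 p)" unfolding p e2_def by simp
      finally show "e1 (h p) = e2 p" by simp
    qed
    finally show ?thesis .
  qed
  also have "fps_series Ev e1 ?one = fps_series Ev w ?one"
  proof -
    define h :: "int \<times> int \<Rightarrow> int \<times> int" where
      "h = (\<lambda>(j, k). let n = (k - j) div 2 in (n, 2 * k - 3 * n))"
    have "bij_betw h Ev Ev"
      by (rule bij_betw_byWitness[where f' = "\<lambda>(n, m). let k =
          (3 * n + m) div 2 in (k - 2 * n, k)"])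
         (auto simp: h_def Let_def Ev_def Od_def; presburger)+
    hence "fps_series Ev e1 ?one = fps_series Ev (\<lambda>p. e1 (h p)) ?one" by (rule fps_series_reindex)
    also have "\<dots> = fps_series Ev w ?one"
    proof (rule fps_series_cong[OF _ refl])
      fix p assume "p \<in> Ev"
      then obtain j k where p: "p = (j, k)" "even (j + k)" by (cases p) (auto simp: Ev_def)
      hence "even (k - j)" by simp
      then obtain n where n: "k - j = 2 * n" by (elim evenE)
      have h: "h p = (n, 2 * k - 3 * n)" using n by (simp add: p h_def)
      have j: "j = k - 2 * n" using n by simp
      have "2 * int (e1 (h p)) = 2 * int (bailey_exp (- 3 * n)) + 2 *
          int (theta_exp 9 2 (2 * k - 3 * n))"
        unfolding h e1_def by simp
      also have "\<dots> = 2 * int (theta_exp 27 9 j) + 2 * int (theta_exp 9 4 k)"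
        unfolding bailey_exp_eq t92 t94 t279 j by (simp add: algebra_simps)
      also have "\<dots> = 2 * int (w p)" unfolding p w_def by simp
      finally show "e1 (h p) = w p" by simp
    qed
    finally show ?thesis .
  qed
  also have "fps_series Od e2 ?one = fps_series Od w ?one"
  proof -
    define h :: "int \<times> int \<Rightarrow> int \<times> int" where
      "h = (\<lambda>(j, k). let n = (k + j - 1) div 2 in (n, 2 * k - 3 * n - 1))"
    have "bij_betw h Od Od"
      by (rule bij_betw_byWitness[where f' = "\<lambda>(n, m). let k =
          (3 * n + m + 1) div 2 in (2 * n + 1 - k, k)"])
         (auto simp: h_def Let_def Ev_def Od_def; presburger)+
    hence "fps_series Od e2 ?one = fps_series Od (\<lambda>p. e2 (h p)) ?one" by (rule fps_series_reindex)
    also have "\<dots> = fps_series Od w ?one"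
    proof (rule fps_series_cong[OF _ refl])
      fix p assume "p \<in> Od"
      then obtain j k where p: "p = (j, k)" "odd (j + k)" by (cases p) (auto simp: Od_def)
      hence "even (k + j - 1)" by presburger
      then obtain n where n: "k + j - 1 = 2 * n" by (elim evenE)
      have h: "h p = (n, 2 * k - 3 * n - 1)" using n by (simp add: p h_def)
      have j: "j = 2 * n + 1 - k" using n by simp
      have "2 * int (e2 (h p)) = 2 * int (bailey_exp (- 3 * n - 1)) + 2 *
          int (theta_exp 9 2 (2 * k - 3 * n - 1))"
        unfolding h e2_def by simp
      also have "\<dots> = 2 * int (theta_exp 27 9 j) + 2 * int (theta_exp 9 4 k)"
        unfolding bailey_exp_eq t92 t94 t279 j by (simp add: algebra_simps)
      also have "\<dots> = 2 * int (w p)" unfolding p w_def by simp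
      finally show "e2 (h p) = w p" by simp
    qed
    finally show ?thesis .
  qed
  also have "fps_series Ev w ?one + fps_series Ev e2 ?one -
      (fps_series Ev e2 ?one + fps_series Od w ?one) =
             fps_series Ev w ?one + (- 1) * fps_series Od w ?one" by simp
  also have "(- 1) * fps_series Od w ?one = fps_series Od w (\<lambda>_. (- 1) * 1)"
    by (rule fps_series_cmult [symmetric], rule locally_finite_subset[OF lfw]) auto
  also have "fps_series Ev w ?one + fps_series Od w (\<lambda>_. (- 1) * 1) = 
     fps_series UNIV w (\<lambda>(j, k). fps_const ((-1) ^ nat \<bar>j\<bar>) * fps_const ((-1) ^ nat \<bar>k\<bar>))"
  proof -
    have sgn: "fps_const ((-1) ^ nat \<bar>j\<bar>) * fps_const ((-1) ^ nat \<bar>k\<bar>) =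
        (if even (j + k) then 1 else -1 :: complex fps)"
      for j k :: int
    proof -
      have m: "fps_const (-1) = (-1 :: complex fps)" by (simp flip: fps_const_neg)
      show ?thesis unfolding fps_const_power[symmetric] m
        by (auto simp: minus_one_power_iff even_nat_iff)
    qed
    show ?thesis unfolding split[OF lfw]
      by (intro arg_cong2[of _ _ _ _ "(+)"] fps_series_cong refl)
          (auto simp: sgn Ev_def Od_def simp del: fps_const_mult)
  qed
  also have "\<dots> = theta 27 9 (-1) * theta 9 4 (-1)"
    unfolding theta_def w_def by (subst fps_series_mult) (auto simp: locally_finite_theta)
  finally show ?thesis .
qed

section \<open>Infinite products over residue classes\<close>

text \<open>The product of \<open>1 - X ^ p\<close> over all \<open>p \<in> S\<close>: factors with \<open>p > k\<close> do not affect
coefficient \<open>k\<close>.\<close>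

definition eprod :: "nat set \<Rightarrow> complex fps" where
  "eprod S = Abs_fps (\<lambda>k. fps_nth (\<Prod>p\<in>{p\<in>S. p \<le> k}. 1 - fps_X ^ p) k)"

lemma eprod_nth:
  assumes "finite J" "J \<subseteq> S" "\<And>p. p \<in> S \<Longrightarrow> p \<le> k \<Longrightarrow> p \<in> J"
  shows "fps_nth (eprod S) k = fps_nth (\<Prod>p\<in>J. 1 - fps_X ^ p) k"
proof -
  let ?A = "{p\<in>S. p \<le> k}"
  have A: "finite ?A" by simp
  have "finite B \<Longrightarrow> (\<forall>p\<in>B. k < p) \<Longrightarrow>
      fps_nth (\<Prod>p\<in>?A \<union> B. 1 - fps_X ^ p :: complex fps) k = fps_nth (\<Prod>p\<in>?A. 1 - fps_X ^ p) k" for B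
  proof (induction B rule: finite_induct)
    case empty
    show ?case by (simp only: Un_empty_right)
  next
    case (insert x B)
    have "x \<notin> ?A \<union> B" using insert by auto
    hence "(\<Prod>p\<in>?A \<union> insert x B. 1 - fps_X ^ p :: complex fps) =
        (\<Prod>p\<in>?A \<union> B. 1 - fps_X ^ p) * (1 - fps_X ^ x)"
      using A insert.hyps(1) by (simp add: mult.commute)
    also have "fps_nth \<dots> k = fps_nth (\<Prod>p\<in>?A \<union> B. 1 - fps_X ^ p :: complex fps) k"
      using insert.prems by (simp add: right_diff_distrib fps_X_power_mult_right_nth)
    also have "\<dots> = fps_nth (\<Prod>p\<in>?A. 1 - fps_X ^ p) k" using insert by blast
    finally show ?case .
  qed
  moreover have "finite (J - ?A)" "\<forall>p\<in>J - ?A. k < p" using assms(1,2) by auto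
  ultimately have "fps_nth (\<Prod>p\<in>?A \<union> (J - ?A). 1 - fps_X ^ p :: complex fps) k = fps_nth (eprod S) k"
    unfolding eprod_def fps_nth_Abs_fps by blast
  moreover have "?A \<union> (J - ?A) = J" using assms(3) by auto
  ultimately show ?thesis by (simp only:)
qed

lemma eprod_tendsto:
  assumes "\<And>N. finite (J N)" "\<And>N. J N \<subseteq> S" "\<And>p. p \<in> S \<Longrightarrow> eventually (\<lambda>N. p \<in> J N) F"
  shows "((\<lambda>N. \<Prod>p\<in>J N. 1 - fps_X ^ p) \<longlongrightarrow> eprod S) F"
proof (rule tendsto_fpsI)
  fix k
  have "eventually (\<lambda>N. \<forall>p\<in>{p\<in>S. p \<le> k}. p \<in> J N) F"
    using assms(3) by (subst eventually_ball_finite_distrib) auto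
  thus "eventually (\<lambda>N. fps_nth (\<Prod>p\<in>J N. 1 - fps_X ^ p) k = fps_nth (eprod S) k) F"
  proof eventually_elim
    case (elim N)
    thus ?case using assms(1,2) by (intro eprod_nth [symmetric]) auto
  qed
qed

lemma eprod_union:
  assumes "S \<inter> T = {}"
  shows "eprod (S \<union> T) = eprod S * eprod T"
proof -
  have *: "(\<lambda>N. \<Prod>p\<in>{p\<in>S. p \<le> N}. 1 - fps_X ^ p) \<longlonglongrightarrow> eprod S" for S
    by (rule eprod_tendsto) (auto intro: eventually_ge_at_top)
  have eq: "(\<Prod>p\<in>{p\<in>S \<union> T. p \<le> N}. 1 - fps_X ^ p :: complex fps) =
        (\<Prod>p\<in>{p\<in>S. p \<le> N}. 1 - fps_X ^ p) * (\<Prod>p\<in>{p\<in>T. p \<le> N}. 1 - fps_X ^ p)" for N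
    using assms by (subst prod.union_disjoint[symmetric]) (auto intro!: prod.cong)
  show ?thesis
    by (rule LIMSEQ_unique[OF *[of "S \<union> T", unfolded eq] tendsto_mult_fps[OF *[of S] *[of T]]])
qed

lemma eprod_nth_0: "0 \<notin> S \<Longrightarrow> fps_nth (eprod S) 0 = 1"
  by (subst eprod_nth[of "{}"]) (auto intro: Nat.gr0I)

lemma eprod_neq_0: "0 \<notin> S \<Longrightarrow> eprod S \<noteq> 0"
  using eprod_nth_0[of S] by auto

text \<open>The product of \<open>1 - X ^ p\<close> over a residue class, written \<open>(X\<^sup>a; X\<^sup>b)\<close> in \<open>q\<close>-series
notation (for \<open>0 < a < b\<close>).\<close>

definition residue_prod :: "nat \<Rightarrow> nat \<Rightarrow> complex fps" where
  "residue_prod b a = eprod {p. p > 0 \<and> p mod b = a}"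

lemma residue_prod_neq_0: "residue_prod b a \<noteq> 0"
  unfolding residue_prod_def by (rule eprod_neq_0) simp

lemma residue_prod_tendsto:
  assumes "0 < a" "a \<le> b"
  shows "(\<lambda>n. \<Prod>i=1..n. 1 - fps_X ^ (b * (i - 1) + a)) \<longlonglongrightarrow> residue_prod b (a mod b)"
proof -
  define h where "h = (\<lambda>i. b * (i - 1) + a)"
  have inj: "inj_on h {1..n}" for n
    using assms by (auto simp: h_def inj_on_def)
  have "(\<lambda>n. \<Prod>p\<in>h ` {1..n}. 1 - fps_X ^ p) \<longlonglongrightarrow> residue_prod b (a mod b)"
    unfolding residue_prod_def
  proof (rule eprod_tendsto)
    fix p assume "p \<in> {p. p > 0 \<and> p mod b = a mod b}"
    hence p: "p > 0" "p mod b = a mod b" by auto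
    have "a \<le> p"
    proof (cases "a = b")
      case True
      thus ?thesis using p by (metis dvd_imp_le mod_0_imp_dvd mod_self)
    next
      case False
      thus ?thesis using p assms by (metis le_neq_implies_less mod_less mod_less_eq_dividend)
    qed
    then obtain j where j: "p = b * j + a"
      using p(2) by (metis mod_eq_nat2E add.commute)
    hence "p = h (Suc j)" by (simp add: h_def)
    hence "p \<in> h ` {1..n}" if "n \<ge> Suc j" for n using that by auto
    thus "eventually (\<lambda>n. p \<in> h ` {1..n}) sequentially"
      by (rule eventually_sequentiallyI)
  qed (use assms in \<open>auto simp: h_def\<close>)
  thus ?thesis unfolding prod.reindex[OF inj] o_def by (simp only: h_def)
qed

lemma qfac_tendsto_residue_prod:
  assumes "b > 0"
  shows "(\<lambda>n. qfac (fps_X ^ b) n) \<longlonglongrightarrow> residue_prod b 0"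
proof -
  have "qfac (fps_X ^ b) n = (\<Prod>i=1..n. 1 - fps_X ^ (b * (i - 1) + b) :: complex fps)" for n
    unfolding qfac_def
  proof (intro prod.cong refl)
    fix i assume "i \<in> {1..n}"
    hence "b * (i - 1) + b = b * i" by (cases i) auto
    thus "1 - (fps_X ^ b) ^ i = (1 - fps_X ^ (b * (i - 1) + b) :: complex fps)"
      by (simp only: power_mult)
  qed
  thus ?thesis using residue_prod_tendsto[OF assms order_refl] by simp
qed

lemma qfac_inf_1: "qfac_inf 1 = eprod {p. p > 0}"
  using LIMSEQ_unique[OF qfac_tendsto[OF _ filterlim_ident, of 1] qfac_tendsto_residue_prod[of 1]]
  by (simp add: residue_prod_def)

lemma reverse_progression:
  assumes "0 < a" "a < (b::nat)" "Suc 0 \<le> i"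
  shows "b * i - a = b * (i - 1) + (b - a)"
  using assms by (cases i) auto

lemma theta_minus_eq_residue_prod:
  assumes "0 < a" "a < b"
  shows "theta b a (-1) = residue_prod b 0 * (residue_prod b (b - a) * residue_prod b a)"
proof -
  let ?P = "\<lambda>a n. \<Prod>i=1..n. 1 - fps_X ^ (b * (i - 1) + a) :: complex fps"
  have L: "(\<lambda>n. qfac (fps_X ^ b) n * (?P (b - a) n * ?P a n)) \<longlonglongrightarrow>
      residue_prod b 0 * (residue_prod b ((b - a) mod b) * residue_prod b (a mod b))"
    using assms by (intro tendsto_mult_fps qfac_tendsto_residue_prod residue_prod_tendsto) auto
  have eq: "qfac (fps_X ^ b) n * (?P (b - a) n * ?P a n) =
         qfac (fps_X ^ b) n * (\<Prod>i=1..n. (1 + fps_const (-1) * fps_X ^ (b * i - a)) *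
             (1 + fps_const (-1) * fps_X ^ (b * (i - 1) + a)))" for n
    unfolding prod.distrib[symmetric]
    by (intro arg_cong2[of _ _ _ _ "(*)"] refl prod.cong)
        (simp_all add: reverse_progression[OF assms] flip: fps_const_neg)
  have "residue_prod b 0 * (residue_prod b ((b - a) mod b) * residue_prod b (a mod b)) =
      theta b a (-1)"
    by (rule LIMSEQ_unique[OF L[unfolded eq] jacobi_triple_product[OF assms]]) simp
  thus ?thesis using assms by simp
qed

text \<open>The factors \<open>1 + X ^ p\<close> of the triple product are turned into \<open>1 - X ^ (2 * p)\<close> by
multiplying with \<open>1 - X ^ p\<close>.\<close>

lemma theta_plus_eq_residue_prod:
  assumes "0 < a" "a < b"
  shows "theta b a 1 * (residue_prod b (b - a) * residue_prod b a) =
      residue_prod b 0 * (residue_prod (2 * b) (2 * (b - a)) * residue_prod (2 * b) (2 * a))"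
proof -
  let ?P = "\<lambda>b a n. \<Prod>i=1..n. 1 - fps_X ^ (b * (i - 1) + a) :: complex fps"
  let ?J = "\<lambda>n. qfac (fps_X ^ b) n *
     (\<Prod>i=1..n. (1 + fps_const 1 * fps_X ^ (b * i - a)) *
         (1 + fps_const 1 * fps_X ^ (b * (i - 1) + a)) :: complex fps)"
  have L: "(\<lambda>n. ?J n * (?P b (b - a) n * ?P b a n)) \<longlonglongrightarrow>
      theta b a 1 * (residue_prod b ((b - a) mod b) * residue_prod b (a mod b))"
    using assms by (intro tendsto_mult_fps jacobi_triple_product residue_prod_tendsto) auto
  have R: "(\<lambda>n. qfac (fps_X ^ b) n * (?P (2 * b) (2 * (b - a)) n * ?P (2 * b) (2 * a) n)) \<longlonglongrightarrow>
                   residue_prod b 0 * (residue_prod (2 * b) ((2 * (b - a)) mod (2 * b)) *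
                       residue_prod (2 * b) ((2 * a) mod (2 * b)))"
    using assms by (intro tendsto_mult_fps qfac_tendsto_residue_prod residue_prod_tendsto) auto
  have eq: "?J n * (?P b (b - a) n * ?P b a n) =
      qfac (fps_X ^ b) n * (?P (2 * b) (2 * (b - a)) n * ?P (2 * b) (2 * a) n)" for n
  proof -
    have sq: "(1 + x) * (1 - x) = 1 - x * x" for x :: "complex fps" by (simp add: algebra_simps)
    have dbl: "(\<Prod>i=1..n. 1 + fps_X ^ (b * (i - 1) + c)) * ?P b c n = ?P (2 * b) (2 * c) n" for c
      unfolding prod.distrib[symmetric]
    proof (intro prod.cong refl)
      fix i
      have "2 * b * (i - 1) + 2 * c = (b * (i - 1) + c) + (b * (i - 1) + c)" by simp
      thus "(1 + fps_X ^ (b * (i - 1) + c)) * (1 - fps_X ^ (b * (i - 1) + c)) =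
          (1 - fps_X ^ (2 * b * (i - 1) + 2 * c) :: complex fps)"
        by (simp only: sq power_add)
    qed
    have J: "?J n = qfac (fps_X ^ b) n * ((\<Prod>i=1..n. 1 + fps_X ^ (b * (i - 1) + (b - a))) *
        (\<Prod>i=1..n. 1 + fps_X ^ (b * (i - 1) + a)))"
      unfolding prod.distrib[symmetric]
      by (intro arg_cong2[of _ _ _ _ "(*)"] refl prod.cong)
          (simp_all add: reverse_progression[OF assms])
    show ?thesis unfolding J dbl[symmetric] by (simp only: mult_ac)
  qed
  have "theta b a 1 * (residue_prod b ((b - a) mod b) * residue_prod b (a mod b)) =
        residue_prod b 0 * (residue_prod (2 * b) ((2 * (b - a)) mod (2 * b)) *
            residue_prod (2 * b) ((2 * a) mod (2 * b)))"
    by (rule LIMSEQ_unique[OF L[unfolded eq] R])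
  thus ?thesis using assms by simp
qed

definition good_parts :: "nat set" where
  "good_parts = {p. p mod 18 \<in> {1, 3, 4, 6, 8, 10, 12, 14, 15, 17}}"

lemma eprod_residues_insert:
  assumes "a \<notin> R"
  shows "eprod {p. p > 0 \<and> p mod b \<in> insert a R} =
      residue_prod b a * eprod {p. p > 0 \<and> p mod b \<in> R}"
proof -
  have "{p. p > 0 \<and> p mod b \<in> insert a R} = {p. p > 0 \<and> p mod b = a} \<union> {p. p > 0 \<and> p mod b \<in> R}"
    by auto
  moreover have "{p. p > 0 \<and> p mod b = a} \<inter> {p. p > 0 \<and> p mod b \<in> R} = {}"
    using assms by auto
  ultimately show ?thesis unfolding residue_prod_def by (simp only: eprod_union)
qed

lemma eprod_residues:
  "distinct rs \<Longrightarrow> eprod {p. p > 0 \<and> p mod b \<in> set rs} = prod_list (map (residue_prod b) rs)"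
proof (induction rs)
  case Nil
  show ?case by (rule fps_ext) (simp add: eprod_def)
next
  case (Cons r rs)
  thus ?case using eprod_residues_insert[of r "set rs" b] by simp
qed

lemma residue_prod_refine:
  assumes "\<And>q. q < c * b \<Longrightarrow> q mod b = a \<longleftrightarrow> q \<in> R" "b > 0" "c > 0"
  shows "residue_prod b a = eprod {p. p > 0 \<and> p mod (c * b) \<in> R}"
proof -
  have "p mod b = a \<longleftrightarrow> p mod (c * b) \<in> R" for p
    using assms(1)[of "p mod (c * b)"] assms(2,3) by (simp add: mod_mod_cancel)
  thus ?thesis by (simp add: residue_prod_def)
qed

lemma residue_prod_split_double: 
  assumes "a < 9"
  shows "residue_prod 9 a = residue_prod 18 a * residue_prod 18 (a + 9)"
proof -
  have "residue_prod 9 a = eprod {p. p > 0 \<and> p mod (2 * 9) \<in> {a, a + 9}}"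
  proof (rule residue_prod_refine)
    fix q :: nat assume "q < 2 * 9"
    thus "q mod 9 = a \<longleftrightarrow> q \<in> {a, a + 9}"
      using assms by (cases "q < 9") (auto simp: le_mod_geq)
  qed auto
  thus ?thesis using eprod_residues[of "[a, a + 9]" 18] by simp
qed

lemma residue_prod_9_0_split: "residue_prod 9 0 =
    residue_prod 27 0 * (residue_prod 27 18 * residue_prod 27 9)"
proof -
  have "residue_prod 9 0 = eprod {p. p > 0 \<and> p mod (3 * 9) \<in> {0, 18, 9}}"
  proof (rule residue_prod_refine)
    fix q :: nat assume "q < 3 * 9"
    thus "q mod 9 = 0 \<longleftrightarrow> q \<in> {0, 18, 9}"
      by (cases "q < 9"; cases "q < 18") (auto simp: le_mod_geq)
  qed auto
  thus ?thesis using eprod_residues[of "[0, 18, 9]" 27] by simp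
qed

text \<open>The residues modulo 18 outside \<open>good_parts\<close> are exactly those in the product form of the
quintuple product: \<open>0\<close>, \<open>7\<close>, \<open>2\<close> modulo 9 and \<open>5\<close>, \<open>13\<close> modulo 18.\<close>

lemma residue_prod_all_split:
  "eprod {p. p > 0} = eprod good_parts * (residue_prod 9 0 *
      (residue_prod 9 7 * (residue_prod 9 2 * (residue_prod 18 5 * residue_prod 18 13))))"
proof -
  define bad where "bad = {p::nat. p > 0 \<and> p mod 18 \<in> {0, 9, 7, 16, 2, 11, 5, 13}}"
  have "{p::nat. p > 0} = good_parts \<union> bad"
  proof (intro equalityI subsetI)
    fix p :: nat assume p: "p \<in> {p. p > 0}"
    define q where "q = p mod 18"
    have "q < 18" by (simp add: q_def)
    hence "q \<in> {0,1,2,3,4,5,6,7,8,9,10,11,12,13,14,15,16,17}"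
      by (simp add: numeral_eq_Suc less_Suc_eq)
    thus "p \<in> good_parts \<union> bad" using p unfolding good_parts_def bad_def q_def by auto
  qed (auto simp: good_parts_def bad_def intro: Nat.gr0I)
  moreover have "good_parts \<inter> bad = {}" by (auto simp: good_parts_def bad_def)
  ultimately have "eprod {p. p > 0} = eprod good_parts * eprod bad" by (simp only: eprod_union)
  also have "eprod bad = residue_prod 9 0 * (residue_prod 9 7 *
      (residue_prod 9 2 * (residue_prod 18 5 * residue_prod 18 13)))"
    unfolding bad_def using residue_prod_split_double[of 0] residue_prod_split_double[of 7]
        residue_prod_split_double[of 2]
      eprod_residues[of "[0, 9, 7, 16, 2, 11, 5, 13]" 18]
    by (simp add: mult.assoc)
  finally show ?thesis .
qed

text \<open>The three theta series of \<open>quintuple_times_triple\<close> are products over residue classes.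
After the cancellation, \<open>bailey_theta\<close> is the product of \<open>1 - X ^ p\<close> over the positive integers
outside \<open>good_parts\<close>, and \<open>bailey_identity\<close> divides it by the product over all positive
integers.\<close>

theorem mod_18_identity: "fps_series UNIV (\<lambda>n. n^2) bailey_beta * eprod good_parts = 1"
proof -
  have B: "theta 9 2 1 * (residue_prod 9 7 * residue_prod 9 2) =
      residue_prod 9 0 * (residue_prod 18 14 * residue_prod 18 4)"
    using theta_plus_eq_residue_prod[of 2 9] by simp
  have P: "theta 27 9 (-1) = residue_prod 9 0"
    using theta_minus_eq_residue_prod[of 9 27] by (simp add: residue_prod_9_0_split)
  have T: "theta 9 4 (-1) = residue_prod 9 0 *
      ((residue_prod 18 5 * residue_prod 18 14) * (residue_prod 18 4 * residue_prod 18 13))"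
    using theta_minus_eq_residue_prod[of 4 9] residue_prod_split_double[of 4]
        residue_prod_split_double[of 5] by simp
  \<comment> \<open>these factors occur on both sides of the identity for the theta series\<close>
  let ?c = "residue_prod 9 0 * (residue_prod 18 14 * residue_prod 18 4)"
  have "bailey_theta * ?c = (bailey_theta * theta 9 2 1) * (residue_prod 9 7 * residue_prod 9 2)"
    unfolding B[symmetric] by (simp only: mult.assoc)
  also have "\<dots> = (residue_prod 9 0 * (residue_prod 9 7 *
      (residue_prod 9 2 * (residue_prod 18 5 * residue_prod 18 13)))) * ?c"
    unfolding quintuple_times_triple P T by (simp only: mult_ac)
  finally have A: "bailey_theta = residue_prod 9 0 *
      (residue_prod 9 7 * (residue_prod 9 2 * (residue_prod 18 5 * residue_prod 18 13)))"
    by (simp add: residue_prod_neq_0)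
  have "(fps_series UNIV (\<lambda>n. n^2) bailey_beta * eprod good_parts) * bailey_theta =
      fps_series UNIV (\<lambda>n. n^2) bailey_beta * qfac_inf 1"
    unfolding qfac_inf_1 residue_prod_all_split A by (simp only: mult_ac)
  also have "\<dots> = 1 * bailey_theta" by (simp only: bailey_identity mult_1_left)
  finally show ?thesis unfolding A by (simp only: mult_cancel_right mult_eq_0_iff
      residue_prod_neq_0 simp_thms)
qed

section \<open>Generating functions of partitions with restricted multiplicities\<close>

definition desc :: "nat multiset \<Rightarrow> nat list" where
  "desc m = rev (sorted_list_of_multiset m)"

lemma mset_desc [simp]: "mset (desc m) = m"
  by (simp add: desc_def)

lemma is_partition_desc: "is_partition (desc m) \<longleftrightarrow> 0 \<notin># m"
  by (force simp: is_partition_def desc_def sorted_wrt_rev intro: Nat.gr0I)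

lemma desc_mset: "is_partition l \<Longrightarrow> desc (mset l) = l"
proof -
  assume "is_partition l"
  hence "sorted (rev l)" by (simp add: is_partition_def sorted_wrt_rev)
  hence "sort l = rev l" by (intro properties_for_sort) auto
  thus ?thesis by (simp add: desc_def)
qed

text \<open>Weakly decreasing lists and multisets determine each other, so partitions may be counted
as multisets of their parts.\<close>

lemma bij_betw_mset_partitions:
  "bij_betw mset {l. is_partition l \<and> Q (mset l)} {m. 0 \<notin># m \<and> Q m}"
  by (rule bij_betw_byWitness[where f' = desc])
     (auto simp: desc_mset is_partition_desc, auto simp: is_partition_def)

definition partitions_with :: "nat set \<Rightarrow> (nat \<Rightarrow> nat set) \<Rightarrow> nat \<Rightarrow> nat list set" where
  "partitions_with S M n =
     {l. partition_of l n \<and> set l \<subseteq> S \<and> (\<forall>j\<in>S. count_list l j \<in> M j)}"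

definition multisets_with :: "nat set \<Rightarrow> (nat \<Rightarrow> nat set) \<Rightarrow> nat \<Rightarrow> nat multiset set" where
  "multisets_with S M n = {m. set_mset m \<subseteq> S \<and> (\<forall>j\<in>S. count m j \<in> M j) \<and> sum_mset m = n}"

text \<open>The generating function of the partitions whose parts are all \<open>j\<close>, with multiplicity in
\<open>A\<close>.\<close>

definition part_gf :: "nat \<Rightarrow> nat set \<Rightarrow> complex fps" where
  "part_gf j A = Abs_fps (\<lambda>k. if j dvd k \<and> k div j \<in> A then 1 else 0)"

lemma bij_betw_partitions_with:
  assumes "0 \<notin> S"
  shows "bij_betw mset (partitions_with S M n) (multisets_with S M n)"
proof -
  let ?Q = "\<lambda>m. set_mset m \<subseteq> S \<and> (\<forall>j\<in>S. count m j \<in> M j) \<and> sum_mset m = n"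
  have "partitions_with S M n = {l. is_partition l \<and> ?Q (mset l)}"
    by (auto simp: partitions_with_def partition_of_def sum_mset_sum_list count_mset)
  moreover have "multisets_with S M n = {m. 0 \<notin># m \<and> ?Q m}"
    using assms by (auto simp: multisets_with_def)
  ultimately show ?thesis using bij_betw_mset_partitions[of ?Q] by simp
qed

lemma multisets_with_insert:
  assumes "j \<notin> S"
  shows "bij_betw (\<lambda>(c, m). m + replicate_mset c j)
           (SIGMA c:{c\<in>M j. j * c \<le> n}. multisets_with S M (n - j * c))
               (multisets_with (insert j S) M n)"
proof (rule bij_betw_byWitness[where f' = "\<lambda>m. (count m j, filter_mset (\<lambda>x. x \<noteq> j) m)"])
  have cnt: "count m j = 0" if "set_mset m \<subseteq> S" for m
    using that assms by (auto simp: not_in_iff[symmetric])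
  have flt: "filter_mset (\<lambda>x. x \<noteq> j) m = m" if "set_mset m \<subseteq> S" for m
    using that assms by (auto simp: filter_mset_eq_conv)
  have split: "filter_mset (\<lambda>x. x \<noteq> j) m + replicate_mset (count m j) j = m" for m
    by (rule multiset_eqI) auto
  have sum: "sum_mset (filter_mset (\<lambda>x. x \<noteq> j) m) + j * count m j = sum_mset m" for m
  proof -
    have "sum_mset (filter_mset (\<lambda>x. x \<noteq> j) m + replicate_mset (count m j) j) = sum_mset m"
      by (simp only: split)
    thus ?thesis by (simp add: mult.commute)
  qed
  show "\<forall>a\<in>SIGMA c:{c \<in> M j. j * c \<le> n}. multisets_with S M (n - j * c).
       (\<lambda>m. (count m j, filter_mset (\<lambda>x. x \<noteq> j) m)) ((\<lambda>(c, m). m + replicate_mset c j) a) = a"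
    by (auto simp: multisets_with_def cnt flt)
  show "\<forall>a'\<in>multisets_with (insert j S) M n.
       (\<lambda>(c, m). m + replicate_mset c j) ((\<lambda>m. (count m j, filter_mset (\<lambda>x. x \<noteq> j) m)) a') = a'"
    using split by simp
  show "(\<lambda>(c, m). m + replicate_mset c j) ` (SIGMA c:{c \<in> M j. j * c \<le> n}. multisets_with S M
      (n - j * c))
      \<subseteq> multisets_with (insert j S) M n"
  proof safe
    fix c m assume c: "c \<in> M j" "j * c \<le> n" and m: "m \<in> multisets_with S M (n - j * c)"
    have "count (m + replicate_mset c j) i \<in> M i" if "i \<in> insert j S" for i
      using that c m assms cnt[of m] by (cases "i = j") (auto simp: multisets_with_def)
    moreover have "sum_mset (m + replicate_mset c j) = n"
      using c m by (simp add: multisets_with_def mult.commute)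
    moreover have "set_mset (m + replicate_mset c j) \<subseteq> insert j S"
      using m by (auto simp: multisets_with_def split: if_splits)
    ultimately show "m + replicate_mset c j \<in> multisets_with (insert j S) M n"
      unfolding multisets_with_def by blast
  qed
  show "(\<lambda>m. (count m j, filter_mset (\<lambda>x. x \<noteq> j) m)) ` multisets_with (insert j S) M n
      \<subseteq> (SIGMA c:{c \<in> M j. j * c \<le> n}. multisets_with S M (n - j * c))"
  proof safe
    fix m assume m: "m \<in> multisets_with (insert j S) M n"
    show "count m j \<in> M j" using m by (simp add: multisets_with_def)
    have s: "sum_mset (filter_mset (\<lambda>x. x \<noteq> j) m) + j * count m j = n"
      using sum[of m] m by (simp add: multisets_with_def)
    show "j * count m j \<le> n" using s by linarith
    show "filter_mset (\<lambda>x. x \<noteq> j) m \<in> multisets_with S M (n - j * count m j)"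
      using m s assms by (auto simp: multisets_with_def)
  qed
qed

lemma multisets_with_gf:
  assumes "finite S" "0 \<notin> S"
  shows "finite (multisets_with S M n) \<and>
         of_nat (card (multisets_with S M n)) = fps_nth (\<Prod>j\<in>S. part_gf j (M j)) n"
  using assms
proof (induction S arbitrary: n rule: finite_induct)
  case empty
  have "multisets_with {} M n = (if n = 0 then {{#}} else {})"
    by (auto simp: multisets_with_def)
  thus ?case by simp
next
  case (insert j S)
  let ?G = "\<Prod>j\<in>S. part_gf j (M j)"
  let ?C = "{c\<in>M j. j * c \<le> n}"
  have j: "j > 0" using insert.prems by auto
  have IH: "finite (multisets_with S M k)" "of_nat (card (multisets_with S M k)) =
      fps_nth ?G k" for k
    using insert by auto
  have "?C \<subseteq> {..n}"
  proof safe
    fix c assume "j * c \<le> n"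
    moreover have "1 * c \<le> j * c" using j by (intro mult_right_mono) auto
    ultimately show "c \<le> n" by linarith
  qed
  hence finC: "finite ?C" by (rule finite_subset) simp
  note bij = multisets_with_insert[OF insert.hyps(2), of M n]
  have fin: "finite (multisets_with (insert j S) M n)"
    using bij_betw_finite[OF bij] finC IH(1) by simp
  have "card (multisets_with (insert j S) M n) = (\<Sum>c\<in>?C. card (multisets_with S M (n - j * c)))"
    using bij_betw_same_card[OF bij] finC IH(1) by simp
  hence "of_nat (card (multisets_with (insert j S) M n)) = (\<Sum>c\<in>?C. fps_nth ?G (n - j * c))"
    by (simp add: IH(2))
  also have "\<dots> = (\<Sum>i\<in>{i\<in>{0..n}. j dvd i \<and> i div j \<in> M j}. fps_nth ?G (n - i))"
    by (rule sum.reindex_bij_witness[of _ "\<lambda>i. i div j" "\<lambda>c. j * c"]) (use j in auto)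
  also have "\<dots> = (\<Sum>i=0..n. if j dvd i \<and> i div j \<in> M j then fps_nth ?G (n - i) else 0)"
    by (rule sum.inter_filter) simp
  also have "\<dots> = fps_nth (part_gf j (M j) * ?G) n"
    unfolding fps_mult_nth by (intro sum.cong) (auto simp: part_gf_def)
  finally show ?case using fin insert.hyps by simp
qed

theorem partitions_with_gf:
  assumes "finite S" "0 \<notin> S"
  shows "finite (partitions_with S M n)"
    "of_nat (card (partitions_with S M n)) = fps_nth (\<Prod>j\<in>S. part_gf j (M j)) n"
  using multisets_with_gf[OF assms, of M n] bij_betw_finite[OF
      bij_betw_partitions_with[OF assms(2), of M n]]
    bij_betw_same_card[OF bij_betw_partitions_with[OF assms(2), of M n]] by auto

lemma geometric_gf:
  assumes "m > 0" "m dvd e"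
  shows "Abs_fps (\<lambda>k. if m dvd k \<and> e \<le> k then 1 else 0) =
      fps_X ^ e * inverse (1 - fps_X ^ m :: complex fps)"
    (is "?F = _")
proof -
  have "fps_nth (?F * (1 - fps_X ^ m)) k = fps_nth (fps_X ^ e) k" for k
  proof (cases "m dvd k")
    case True
    obtain a b where ab: "k = m * a" "e = m * b" using True assms by (auto elim!: dvdE)
    have "m \<le> k \<and> e \<le> k - m \<longleftrightarrow> b < a"
    proof -
      have "m \<le> k \<and> e \<le> k - m \<longleftrightarrow> e + m \<le> k" by linarith
      also have "\<dots> \<longleftrightarrow> m * Suc b \<le> m * a" using ab by (simp add: add.commute)
      finally show ?thesis using assms(1) by (simp only: mult_le_cancel1 Suc_le_eq simp_thms)
    qed
    moreover have "e \<le> k \<longleftrightarrow> b \<le> a" "e = k \<longleftrightarrow> b = a" using ab assms by auto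
    ultimately show ?thesis using True
      by (auto simp: right_diff_distrib fps_X_power_mult_right_nth fps_X_power_nth)
  next
    case False
    hence "k \<noteq> e" "m \<le> k \<longrightarrow> \<not> m dvd k - m" using assms by (auto simp: dvd_minus_self)
    thus ?thesis using False by (auto simp: right_diff_distrib fps_X_power_mult_right_nth
        fps_X_power_nth)
  qed
  hence F: "?F * (1 - fps_X ^ m) = fps_X ^ e" by (rule fps_ext)
  have inv: "(1 - fps_X ^ m) * inverse (1 - fps_X ^ m :: complex fps) = 1"
    using assms by (intro inverse_mult_eq_1') (simp add: fps_X_power_nth)
  have "?F = ?F * ((1 - fps_X ^ m) * inverse (1 - fps_X ^ m))" by (simp only: inv mult_1_right)
  also have "\<dots> = fps_X ^ e * inverse (1 - fps_X ^ m)" by (simp only: F flip: mult.assoc)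
  finally show ?thesis .
qed

lemma part_gf_UNIV: "j > 0 \<Longrightarrow> part_gf j UNIV = inverse (1 - fps_X ^ j)"
  using geometric_gf[of j 0] by (simp add: part_gf_def)

lemma part_gf_positive:
  assumes "j > 0"
  shows "part_gf j {c. c \<ge> 1} = fps_X ^ j * inverse (1 - fps_X ^ j)"
proof -
  have "j dvd k \<and> k div j \<in> {c. c \<ge> 1} \<longleftrightarrow> j dvd k \<and> j \<le> k" for k
    using assms by (auto elim!: dvdE)
  thus ?thesis using geometric_gf[of j j] assms by (simp add: part_gf_def)
qed

lemma part_gf_even_positive:
  assumes "j > 0"
  shows "part_gf j {c. even c \<and> c \<ge> 2} = fps_X ^ (2 * j) * inverse (1 - fps_X ^ (2 * j))"
proof -
  have "j dvd k \<and> k div j \<in> {c. even c \<and> c \<ge> 2} \<longleftrightarrow> 2 * j dvd k \<and> 2 * j \<le> k" for k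
  proof (cases "j dvd k")
    case True
    then obtain c where "k = j * c" by (elim dvdE)
    thus ?thesis using assms by (simp add: mult.commute[of 2 j])
  next
    case False
    thus ?thesis using dvd_mult_right by blast
  qed
  thus ?thesis using geometric_gf[of "2 * j" "2 * j"] assms by (simp add: part_gf_def)
qed

section \<open>The signed partitions\<close>

definition allowed_multiplicities :: "nat \<Rightarrow> nat \<Rightarrow> nat set" where
  "allowed_multiplicities m j = (if j < m then {c. even c \<and> c \<ge> 2} else {c. c \<ge> 1})"

definition positive_lists :: "nat \<Rightarrow> nat \<Rightarrow> nat list set" where
  "positive_lists m n = partitions_with {1..<Suc (2*m)} (allowed_multiplicities m) n"

lemma mem_positive_lists_iff:
  assumes "m \<ge> 1"
  shows "\<pi> \<in> positive_lists m n \<longleftrightarrow> partition_of \<pi> n \<and> \<pi> \<noteq> [] \<and> largest_part \<pi> = 2 * m \<and>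
    (\<forall>j\<in>{1..m - 1}. even (count_list \<pi> j) \<and> count_list \<pi> j \<ge> 2) \<and>
    (\<forall>j\<in>{m..2*m}. count_list \<pi> j \<ge> 1)" (is "?L \<longleftrightarrow> ?R")
proof
  assume L: ?L
  have part: "partition_of \<pi> n" and sub: "set \<pi> \<subseteq> {1..<Suc (2*m)}"
    and cnt: "\<And>j. j \<in> {1..<Suc (2*m)} \<Longrightarrow> count_list \<pi> j \<in> allowed_multiplicities m j"
    using L by (auto simp: positive_lists_def partitions_with_def)
  have "count_list \<pi> (2*m) \<ge> 1" using cnt[of "2*m"] assms by (simp add: allowed_multiplicities_def)
  hence mem: "2 * m \<in> set \<pi>" by (metis count_notin not_one_le_zero)
  then obtain h t where pi: "\<pi> = h # t" by (cases \<pi>) auto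
  have "2 * m \<le> h" using mem part pi by (auto simp: partition_of_def is_partition_def)
  moreover have "h \<le> 2 * m" using sub pi by auto
  ultimately have "largest_part \<pi> = 2 * m" by (simp add: largest_part_def pi)
  moreover have "even (count_list \<pi> j) \<and> count_list \<pi> j \<ge> 2" if "j \<in> {1..m - 1}" for j
  proof -
    have "1 \<le> j" "j \<le> m - 1" using that by auto
    hence "j < m" by linarith
    thus ?thesis using cnt[of j] \<open>1 \<le> j\<close> by (simp add: allowed_multiplicities_def)
  qed
  moreover have "count_list \<pi> j \<ge> 1" if "j \<in> {m..2*m}" for j
    using cnt[of j] that assms by (auto simp: allowed_multiplicities_def)
  ultimately show ?R using part pi by simp
next
  assume R: ?R
  then obtain h t where pi: "\<pi> = h # t" by (cases \<pi>) auto
  have "set \<pi> \<subseteq> {1..<Suc (2*m)}"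
  proof
    fix x assume x: "x \<in> set \<pi>"
    have "x > 0" using x R by (auto simp: partition_of_def is_partition_def)
    moreover have "x \<le> h" using x R pi by (auto simp: partition_of_def is_partition_def)
    moreover have "h = 2 * m" using R pi by (simp add: largest_part_def)
    ultimately show "x \<in> {1..<Suc (2*m)}" by simp
  qed
  moreover have "count_list \<pi> j \<in> allowed_multiplicities m j" if "j \<in> {1..<Suc (2*m)}" for j
  proof (cases "j < m")
    case True
    hence "j \<in> {1..m - 1}" using that by auto
    thus ?thesis using R True by (simp add: allowed_multiplicities_def)
  next
    case False
    hence "j \<in> {m..2*m}" using that by auto
    thus ?thesis using R False by (simp add: allowed_multiplicities_def)
  qed
  ultimately show ?L using R by (simp add: positive_lists_def partitions_with_def)
qed

text \<open>The multiset of negative parts that corresponds to a set \<open>T \<subseteq> {1..<m}\<close>: the parts greater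
than 2 are distinct and of the form \<open>3 * i + 2\<close>, and the number of twos follows from the total
number \<open>m\<close> of parts.\<close>

definition negative_parts :: "nat \<Rightarrow> nat set \<Rightarrow> nat multiset" where
  "negative_parts m T = mset_set ((\<lambda>i. 3 * i + 2) ` T) + replicate_mset (m - card T) 2"

lemma inj_on_3_times_plus_2: "inj_on (\<lambda>i::nat. 3 * i + 2) T"
  by (auto simp: inj_on_def)

lemma card_image_3_times_plus_2: "card ((\<lambda>i::nat. 3 * i + 2) ` T) = card T"
  by (rule card_image[OF inj_on_3_times_plus_2])

lemma sum_negative_parts:
  assumes "T \<subseteq> {1..<m}"
  shows "sum_mset (negative_parts m T) = 2 * m + 3 * \<Sum>T"
proof -
  have fin: "finite T" using assms finite_subset by blast
  have "card T \<le> m" using card_mono[OF _ assms] by simp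
  have "sum_mset (mset_set ((\<lambda>i. 3 * i + 2) ` T)) = (\<Sum>i\<in>T. 3 * i + 2)"
    using sum_unfold_sum_mset[of "\<lambda>x. x" "(\<lambda>i. 3 * i + 2) ` T"]
        sum.reindex[OF inj_on_3_times_plus_2, of "\<lambda>x. x" T] by simp
  also have "\<dots> = 3 * \<Sum>T + 2 * card T" by (simp only: sum.distrib sum_distrib_left) simp
  finally show ?thesis using \<open>card T \<le> m\<close> by (simp add: negative_parts_def)
qed

lemma set_negative_parts:
  "finite T \<Longrightarrow> set_mset (negative_parts m T) \<subseteq> (\<lambda>i. 3 * i + 2) ` T \<union> {2}"
  "finite T \<Longrightarrow> (\<lambda>i. 3 * i + 2) ` T \<subseteq> set_mset (negative_parts m T)"
  by (auto simp: negative_parts_def split: if_splits)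

lemma inj_negative_parts: "inj_on (\<lambda>T. desc (negative_parts m T)) (Pow {1..<m})"
proof (rule inj_onI)
  fix T U assume TU: "T \<in> Pow {1..<m}" "U \<in> Pow {1..<m}" and "desc (negative_parts m T) =
      desc (negative_parts m U)"
  hence eq: "negative_parts m T = negative_parts m U" by (metis mset_desc)
  have "T = {i\<in>{1..<m}. 3 * i + 2 \<in># negative_parts m T}" if "T \<in> Pow {1..<m}" for T
  proof -
    have "finite T" using that finite_subset by blast
    thus ?thesis using set_negative_parts[of T m] that by auto
  qed
  thus "T = U" using TU eq by metis
qed

lemma negative_parts_iff:
  assumes "m \<ge> 1"
  shows "is_partition \<nu> \<and> length \<nu> = m \<and>
            (\<forall>p \<in> set \<nu>. [p = 2] (mod 3) \<and> p \<le> 3 * m - 1 \<and> (p > 2 \<longrightarrow> count_list \<nu> p \<le> 1))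
         \<longleftrightarrow> (\<exists>T\<in>Pow {1..<m}. \<nu> = desc (negative_parts m T))" (is "?L \<longleftrightarrow> ?R")
proof
  assume L: ?L
  define T where "T = {i\<in>{1..<m}. 3 * i + 2 \<in> set \<nu>}"
  let ?N = "mset \<nu>"
  have form: "p = 2 \<or> (\<exists>i\<in>T. p = 3 * i + 2)" if "p \<in> set \<nu>" for p
  proof -
    have "p mod 3 = 2" "p \<le> 3 * m - 1" using L that by (auto simp: cong_def)
    moreover define i where "i = p div 3"
    ultimately have "p = 3 * i + 2" "i < m" using div_mult_mod_eq[of p 3] assms by linarith+
    thus ?thesis using that by (cases "i = 0") (auto simp: T_def)
  qed
  have finT: "finite T" by (simp add: T_def)
  have "filter_mset (\<lambda>p. p > 2) ?N = mset_set ((\<lambda>i. 3 * i + 2) ` T)"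
  proof (rule multiset_eqI)
    fix p
    show "count (filter_mset (\<lambda>p. p > 2) ?N) p = count (mset_set ((\<lambda>i. 3 * i + 2) ` T)) p"
    proof (cases "p \<in> set \<nu> \<and> p > 2")
      case True
      hence "count_list \<nu> p \<le> 1" "count_list \<nu> p \<noteq> 0" using L by (auto simp: count_list_0_iff)
      hence "count ?N p = 1" by (simp add: count_mset)
      moreover have "p \<in> (\<lambda>i. 3 * i + 2) ` T" using form[of p] True by auto
      ultimately show ?thesis using True finT by (simp add: count_mset_set')
    next
      case False
      hence "p \<notin> (\<lambda>i. 3 * i + 2) ` T" by (auto simp: T_def)
      thus ?thesis using False by (auto simp: count_mset_set' count_mset)
    qed
  qed
  moreover have "filter_mset (\<lambda>p. \<not> p > 2) ?N = replicate_mset (m - card T) 2"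
  proof -
    have "set_mset (filter_mset (\<lambda>p. \<not> p > 2) ?N) \<subseteq> {2}"
    proof
      fix x assume x: "x \<in># filter_mset (\<lambda>p. \<not> p > 2) ?N"
      hence "x = 2 \<or> (\<exists>i\<in>T. x = 3 * i + 2)" using form[of x] by simp
      thus "x \<in> {2}" using x by (elim disjE bexE) simp_all
    qed
    hence rep: "filter_mset (\<lambda>p. \<not> p > 2) ?N =
        replicate_mset (size (filter_mset (\<lambda>p. \<not> p > 2) ?N)) 2"
      by (rule set_mset_subset_singletonD)
    have "size ?N = size (filter_mset (\<lambda>p. p > 2) ?N) + size (filter_mset (\<lambda>p. \<not> p > 2) ?N)"
      by (metis multiset_partition size_union)
    moreover have "size ?N = m" using L by simp
    moreover have "size (filter_mset (\<lambda>p. p > 2) ?N) = card T"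
      unfolding \<open>filter_mset (\<lambda>p. p > 2) ?N = mset_set ((\<lambda>i. 3 * i + 2) ` T)\<close>
        by (simp only: size_mset_set card_image_3_times_plus_2)
    ultimately have "size (filter_mset (\<lambda>p. \<not> p > 2) ?N) = m - card T" by linarith
    with rep show ?thesis by (simp only:)
  qed
  ultimately have "?N = negative_parts m T"
    unfolding negative_parts_def using multiset_partition[of ?N "\<lambda>p. p > 2"] by simp
  hence "\<nu> = desc (negative_parts m T)" using desc_mset[of \<nu>] L by simp
  thus ?R by (auto simp: T_def)
next
  assume ?R
  then obtain T where T: "T \<subseteq> {1..<m}" and nu: "\<nu> = desc (negative_parts m T)" by auto
  have fin: "finite T" using T finite_subset by blast
  have cardT: "card T \<le> m" using card_mono[OF _ T] by simp
  have N: "mset \<nu> = negative_parts m T" by (simp add: nu)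
  have set: "set \<nu> = set_mset (negative_parts m T)" using N by (metis set_mset_mset)
  have "0 \<notin># negative_parts m T" using set_negative_parts(1)[OF fin, of m] by auto
  hence "is_partition \<nu>" unfolding nu is_partition_desc .
  moreover have "length \<nu> = m"
  proof -
    have "size (mset \<nu>) = m"
      unfolding N negative_parts_def using cardT by
          (simp only: size_union size_mset_set size_replicate_mset card_image_3_times_plus_2)
    thus ?thesis by simp
  qed
  moreover have "[p = 2] (mod 3) \<and> p \<le> 3 * m - 1 \<and>
      (p > 2 \<longrightarrow> count_list \<nu> p \<le> 1)" if "p \<in> set \<nu>" for p
  proof -
    have "p = 2 \<or> (\<exists>i\<in>T. p = 3 * i + 2)" using that set set_negative_parts(1)[OF fin, of m] by auto
    moreover have "i < m" if "i \<in> T" for i using that T by auto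
    ultimately obtain i where i: "p = 3 * i + 2" "i < m" using assms
      by (metis add_0 less_le_trans less_one mult_0_right)
    have "(3 * i + 2) mod 3 = 2" by presburger
    hence "[p = 2] (mod 3)" unfolding i(1) by (simp only: cong_def) simp
    moreover have "p \<le> 3 * m - 1" using i by linarith
    moreover have "count_list \<nu> p \<le> 1" if "p > 2"
      unfolding count_mset[symmetric] N negative_parts_def using that by (simp add: count_mset_set')
    ultimately show ?thesis by blast
  qed
  ultimately show ?L by blast
qed

definition positive_gf :: "nat \<Rightarrow> complex fps" where
  "positive_gf m = (\<Prod>j\<in>{1..<Suc (2*m)}. part_gf j (allowed_multiplicities m j))"

lemma sum_upper_half:
  assumes "m \<ge> 1"
  shows "\<Sum>{m..<Suc (2*m)} = m^2 + 2 * m + \<Sum>{1..<m}"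
proof -
  have "\<Sum>{0+m..<Suc m+m} = (\<Sum>i=0..<Suc m. i + m)"
    by (rule sum.shift_bounds_nat_ivl)
  also have "\<dots> = (\<Sum>i=0..<Suc m. i) + Suc m * m" by (simp add: sum.distrib)
  also have "(\<Sum>i=0..<Suc m. i) = \<Sum>{1..<m} + m"
    using assms by (simp add: sum.atLeast_Suc_lessThan)
  finally show ?thesis by (simp add: power2_eq_square mult_2)
qed

text \<open>\<open>R\<close> accounts for the multiplicities beyond the forced ones. It becomes \<open>bailey_beta m\<close>
because \<open>(1 + x\<^sup>3) * (1 - x) = (1 - x + x\<^sup>2) * (1 - x\<^sup>2)\<close> for \<open>x = X ^ i\<close>.\<close>

lemma positive_gf_eq:
  assumes m: "m \<ge> 1"
  obtains R where "positive_gf m = fps_X ^ (m^2 + 2 * m + 3 * \<Sum>{1..<m}) * R"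
    "(\<Prod>i=1..<m. 1 + fps_X ^ (3 * i)) * R = bailey_beta m"
proof -
  let ?X = "fps_X :: complex fps"
  define D where "D = (\<Prod>j=1..<m. 1 - ?X ^ (2 * j)) * (\<Prod>j=m..<Suc (2*m). 1 - ?X ^ j)"
  define R where "R = (\<Prod>j=1..<m. inverse (1 - ?X ^ (2 * j))) *
      (\<Prod>j=m..<Suc (2*m). inverse (1 - ?X ^ j))"
  have inv: "(1 - ?X ^ j) * inverse (1 - ?X ^ j) = 1" if "j \<ge> 1" for j
    using that by (intro inverse_mult_eq_1') (auto simp: fps_X_power_nth)
  have "D * R = (\<Prod>j=1..<m. (1 - ?X ^ (2 * j)) * inverse (1 - ?X ^ (2 * j))) *
                (\<Prod>j=m..<Suc (2*m). (1 - ?X ^ j) * inverse (1 - ?X ^ j))"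
    unfolding D_def R_def prod.distrib by (simp only: mult_ac)
  also have "\<dots> = 1" using m by (simp add: inv del: prod.op_ivl_Suc)
  finally have DR: "D * R = 1" .
  have "positive_gf m = (\<Prod>j=1..<m. part_gf j (allowed_multiplicities m j)) *
      (\<Prod>j=m..<Suc (2*m). part_gf j (allowed_multiplicities m j))"
    unfolding positive_gf_def using m by (subst prod.atLeastLessThan_concat) auto
  also have "(\<Prod>j=1..<m. part_gf j (allowed_multiplicities m j)) =
      (\<Prod>j=1..<m. ?X ^ (2 * j) * inverse (1 - ?X ^ (2 * j)))"
    by (intro prod.cong refl) (simp add: allowed_multiplicities_def part_gf_even_positive)
  also have "(\<Prod>j=m..<Suc (2*m). part_gf j (allowed_multiplicities m j)) =
      (\<Prod>j=m..<Suc (2*m). ?X ^ j * inverse (1 - ?X ^ j))"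
    using m by (intro prod.cong refl) (simp add: allowed_multiplicities_def
        part_gf_positive[simplified])
  also have "(\<Prod>j=1..<m. ?X ^ (2 * j) * inverse (1 - ?X ^ (2 * j))) *
      (\<Prod>j=m..<Suc (2*m). ?X ^ j * inverse (1 - ?X ^ j)) =
        ?X ^ (\<Sum>j=1..<m. 2 * j) * ?X ^ (\<Sum>{m..<Suc (2*m)}) * R"
    unfolding prod.distrib R_def power_sum by (simp only: mult_ac)
  also have "?X ^ (\<Sum>j=1..<m. 2 * j) * ?X ^ (\<Sum>{m..<Suc (2*m)}) = ?X ^ (m^2 + 2 * m + 3 * \<Sum>{1..<m})"
    unfolding sum_upper_half[OF m] sum_distrib_left[symmetric] power_add[symmetric]
      by (simp add: algebra_simps)
  finally have 1: "positive_gf m = ?X ^ (m^2 + 2 * m + 3 * \<Sum>{1..<m}) * R" .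
  have "qfac ?X (2*m) = (\<Prod>j=1..<Suc (2*m). 1 - ?X ^ j)"
    by (simp only: qfac_def atLeastLessThanSuc_atLeastAtMost)
  also have "\<dots> = (\<Prod>j=1..<m. 1 - ?X ^ j) * (\<Prod>j=m..<Suc (2*m). 1 - ?X ^ j)"
    using m by (subst prod.atLeastLessThan_concat) auto
  finally have q: "qfac ?X (2*m) = \<dots>" .
  have c: "cyclotomic6_prod ?X (m - 1) = (\<Prod>i=1..<m. 1 - ?X ^ i + ?X ^ (2 * i))"
    unfolding cyclotomic6_prod_def using m by (intro prod.cong) auto
  have "(\<Prod>i=1..<m. 1 + ?X ^ (3 * i)) * qfac ?X (2*m) = 
        (\<Prod>i=1..<m. (1 + ?X ^ (3 * i)) * (1 - ?X ^ i)) * (\<Prod>j=m..<Suc (2*m). 1 - ?X ^ j)"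
    unfolding q prod.distrib by (simp only: mult_ac)
  also have "(\<Prod>i=1..<m. (1 + ?X ^ (3 * i)) * (1 - ?X ^ i)) =
      (\<Prod>i=1..<m. (1 - ?X ^ i + ?X ^ (2 * i)) * (1 - ?X ^ (2 * i)))"
  proof (intro prod.cong refl)
    fix i
    have "(1 + y * y * y) * (1 - y) = (1 - y + y * y) * (1 - y * y)" for y :: "complex fps"
      by (simp add: algebra_simps)
    moreover have "?X ^ (3 * i) = ?X ^ i * ?X ^ i * ?X ^ i" "?X ^ (2 * i) = ?X ^ i * ?X ^ i"
      by (simp_all add: mult_2 numeral_3_eq_3 power_add)
    ultimately show "(1 + ?X ^ (3 * i)) * (1 - ?X ^ i) =
        (1 - ?X ^ i + ?X ^ (2 * i)) * (1 - ?X ^ (2 * i))"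
      by (simp only:)
  qed
  also have "\<dots> * (\<Prod>j=m..<Suc (2*m). 1 - ?X ^ j) = cyclotomic6_prod ?X (m - 1) * D"
    unfolding c D_def prod.distrib by (simp only: mult_ac)
  finally have main: "(\<Prod>i=1..<m. 1 + ?X ^ (3 * i)) * qfac ?X (2*m) =
      cyclotomic6_prod ?X (m - 1) * D" .
  have "(\<Prod>i=1..<m. 1 + ?X ^ (3 * i)) * R =
        ((\<Prod>i=1..<m. 1 + ?X ^ (3 * i)) * qfac ?X (2*m)) * inv_qfac (2*m) * R"
    by (simp only: mult.assoc[of _ "qfac ?X (2*m)"] qfac_mult_inv_qfac mult_1_right)
  also have "\<dots> = cyclotomic6_prod ?X (m - 1) * inv_qfac (2*m) * (D * R)" unfolding main
    by (simp only: mult_ac)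
  also have "\<dots> = bailey_beta m" using m by (simp add: DR bailey_beta_def)
  finally show ?thesis using 1 that by blast
qed

text \<open>Replacing \<open>T\<close> by its complement makes all exponents non-negative, and
\<open>\<Prod>i. 1 + X ^ (3 * i)\<close> expands into the sum over all subsets.\<close>

lemma sum_over_negative_parts:
  assumes m: "m \<ge> 1"
  shows "(\<Sum>T\<in>Pow {1..<m}. fps_nth (positive_gf m) (n + (2 * m + 3 * \<Sum>T))) =
      fps_nth (bailey_beta m * fps_X ^ (m^2)) n"
proof -
  obtain R where P: "positive_gf m = fps_X ^ (m^2 + 2 * m + 3 * \<Sum>{1..<m}) * R"
    and R: "(\<Prod>i=1..<m. 1 + fps_X ^ (3 * i)) * R = bailey_beta m"
    using positive_gf_eq[OF m] by blast
  let ?I = "{1..<m}"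
  have "(\<Sum>T\<in>Pow ?I. fps_nth (positive_gf m) (n + (2 * m + 3 * \<Sum>T))) =
        (\<Sum>T\<in>Pow ?I. fps_nth (fps_X ^ (m^2 + 3 * \<Sum>(?I - T)) * R) n)"
  proof (intro sum.cong refl)
    fix T assume "T \<in> Pow ?I"
    hence "\<Sum>T + \<Sum>(?I - T) = \<Sum>?I" by (subst add.commute) (simp add: sum.subset_diff[symmetric])
    hence e: "m^2 + 2 * m + 3 * \<Sum>?I = (2 * m + 3 * \<Sum>T) + (m^2 + 3 * \<Sum>(?I - T))" by simp
    show "fps_nth (positive_gf m) (n + (2 * m + 3 * \<Sum>T)) =
        fps_nth (fps_X ^ (m^2 + 3 * \<Sum>(?I - T)) * R) n"
      unfolding P e power_add[of _ "2 * m + 3 * \<Sum>T"] mult.assoc by (simp add: fps_X_power_mult_nth)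
  qed
  also have "\<dots> = (\<Sum>T\<in>Pow ?I. fps_nth (fps_X ^ (m^2 + 3 * \<Sum>T) * R) n)"
    by (rule sum.reindex_bij_witness[of _ "\<lambda>T. ?I - T" "\<lambda>T. ?I - T"]) (auto simp: double_diff)
  also have "\<dots> = fps_nth ((\<Sum>T\<in>Pow ?I. \<Prod>i\<in>T. fps_X ^ (3 * i)) * R * fps_X ^ (m^2)) n"
    unfolding fps_sum_nth[symmetric] sum_distrib_right
    by (simp only: power_add power_sum[symmetric] sum_distrib_left mult_ac)
  also have "(\<Sum>T\<in>Pow ?I. \<Prod>i\<in>T. fps_X ^ (3 * i)) = (\<Prod>i=1..<m. 1 + fps_X ^ (3 * i) :: complex fps)"
    using prod_add[of ?I "\<lambda>i. fps_X ^ (3 * i) :: complex fps" "\<lambda>_. 1"] by (simp add: add.commute)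
  finally show ?thesis by (simp only: R)
qed

definition signed_class :: "nat \<Rightarrow> nat \<Rightarrow> (nat list \<times> nat list) set" where
  "signed_class m n = {(\<pi>, \<nu>). signed_partition_of (\<pi>, \<nu>) (int n) \<and> \<pi> \<noteq> [] \<and>
            largest_part \<pi> = 2 * m \<and>
            (\<forall>j \<in> {1..m - 1}. even (count_list \<pi> j) \<and> count_list \<pi> j \<ge> 2) \<and>
            (\<forall>j \<in> {m..2 * m}. count_list \<pi> j \<ge> 1) \<and>
            length \<nu> = m \<and>
            (\<forall>p \<in> set \<nu>. [p = 2] (mod 3) \<and> p \<le> 3 * m - 1 \<and>
               (p > 2 \<longrightarrow> count_list \<nu> p \<le> 1))}"

lemma signed_class_eq:
  assumes m: "m \<ge> 1"
  shows "signed_class m n = (\<lambda>(T, \<pi>). (\<pi>, desc (negative_parts m T))) `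
           (SIGMA T:Pow {1..<m}. positive_lists m (n + (2 * m + 3 * \<Sum>T)))" (is "_ = ?h ` ?S")
proof -
  have sum: "sum_list (desc (negative_parts m T)) = 2 * m + 3 * \<Sum>T" if "T \<in> Pow {1..<m}" for T
    using sum_negative_parts[of T m] that by (simp flip: sum_mset_sum_list)
  have "(\<pi>, \<nu>) \<in> signed_class m n \<longleftrightarrow> (\<exists>T\<in>Pow {1..<m}. \<nu> = desc (negative_parts m T) \<and>
            \<pi> \<in> positive_lists m (n + sum_list \<nu>))" for \<pi> \<nu>
  proof -
    have "signed_partition_of (\<pi>, \<nu>) (int n) \<longleftrightarrow> partition_of \<pi> (n + sum_list \<nu>) \<and> is_partition \<nu>"
      by (auto simp: signed_partition_of_def partition_of_def)
    hence "(\<pi>, \<nu>) \<in> signed_class m n \<longleftrightarrow> \<pi> \<in> positive_lists m (n + sum_list \<nu>) \<and>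
        (is_partition \<nu> \<and> length \<nu> = m \<and>
            (\<forall>p \<in> set \<nu>. [p = 2] (mod 3) \<and> p \<le> 3 * m - 1 \<and> (p > 2 \<longrightarrow> count_list \<nu> p \<le> 1)))"
      unfolding signed_class_def mem_positive_lists_iff[OF m] mem_Collect_eq prod.case by blast
    thus ?thesis unfolding negative_parts_iff[OF m] by blast
  qed
  hence mem: "(\<pi>, \<nu>) \<in> signed_class m n \<longleftrightarrow> (\<exists>T\<in>Pow {1..<m}. \<nu> = desc (negative_parts m T) \<and>
            \<pi> \<in> positive_lists m (n + (2 * m + 3 * \<Sum>T)))" for \<pi> \<nu>
    using sum by metis
  show ?thesis
  proof (intro set_eqI)
    fix x show "x \<in> signed_class m n \<longleftrightarrow> x \<in> ?h ` ?S"
      by (cases x) (auto simp: mem image_iff)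
  qed
qed

lemma signed_class_gf:
  assumes m: "m \<ge> 1"
  shows "finite (signed_class m n)"
    "of_nat (card (signed_class m n)) = fps_nth (bailey_beta m * fps_X ^ (m^2)) n"
proof -
  let ?S = "SIGMA T:Pow {1..<m}. positive_lists m (n + (2 * m + 3 * \<Sum>T))"
  have pos: "finite (positive_lists m k)" "of_nat (card (positive_lists m k)) =
      fps_nth (positive_gf m) k" for k
    unfolding positive_lists_def positive_gf_def by (rule partitions_with_gf; simp)+
  have finS: "finite ?S" using pos(1) by auto
  show "finite (signed_class m n)" unfolding signed_class_eq[OF m] using finS by simp
  have "inj_on (\<lambda>(T, \<pi>). (\<pi>, desc (negative_parts m T))) ?S"
    using inj_negative_parts[of m] by (auto simp: inj_on_def)
  hence "card (signed_class m n) = card ?S" unfolding signed_class_eq[OF m] by (rule card_image)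
  also have "\<dots> = (\<Sum>T\<in>Pow {1..<m}. card (positive_lists m (n + (2 * m + 3 * \<Sum>T))))"
    using pos(1) by (intro card_SigmaI) auto
  finally have "of_nat (card (signed_class m n)) =
      (\<Sum>T\<in>Pow {1..<m}. fps_nth (positive_gf m) (n + (2 * m + 3 * \<Sum>T)))"
    by (simp only: of_nat_sum pos(2))
  thus "of_nat (card (signed_class m n)) = fps_nth (bailey_beta m * fps_X ^ (m^2)) n"
    by (simp only: sum_over_negative_parts[OF m])
qed

text \<open>The net weight is at least \<open>m\<^sup>2\<close>, as the generating function shows.\<close>

lemma signed_class_empty:
  assumes "m > n"
  shows "signed_class m n = {}"
proof -
  have m: "m \<ge> 1" using assms by simp
  have "n < m^2" using assms m by (metis le_trans linorder_not_le power2_nat_le_imp_le)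
  hence "of_nat (card (signed_class m n)) = (0::complex)"
    unfolding signed_class_gf(2)[OF m] by (simp add: fps_X_power_mult_right_nth)
  thus ?thesis using signed_class_gf(1)[OF m, of n] by simp
qed

section \<open>The theorem\<close>

text \<open>Only the parts up to \<open>n\<close> matter for coefficient \<open>n\<close>, so the infinite product of
\<open>mod_18_identity\<close> may be replaced by a finite one.\<close>

lemma card_good_partitions:
  "of_nat (card {l. partition_of l n \<and> set l \<subseteq> good_parts}) =
      fps_nth (fps_series UNIV (\<lambda>n. n^2) bailey_beta) n"
proof -
  let ?S = "{p\<in>good_parts. p \<le> n}"
  have good0: "0 \<notin> good_parts" by (simp add: good_parts_def)
  have le: "p \<le> n" if "partition_of l n" "p \<in> set l" for l p
    using that member_le_sum_list[of p l] by (auto simp: partition_of_def)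
  have "{l. partition_of l n \<and> set l \<subseteq> good_parts} = partitions_with ?S (\<lambda>_. UNIV) n"
    using le by (auto simp: partitions_with_def)
  hence "of_nat (card {l. partition_of l n \<and> set l \<subseteq> good_parts}) =
      fps_nth (\<Prod>j\<in>?S. part_gf j UNIV) n"
    using partitions_with_gf(2)[of ?S "\<lambda>_. UNIV" n] good0 by simp
  also have "(\<Prod>j\<in>?S. part_gf j UNIV) = (\<Prod>j\<in>?S. inverse (1 - fps_X ^ j))"
    using good0 by (intro prod.cong refl part_gf_UNIV) (auto intro: Nat.gr0I)
  finally have 1: "of_nat (card {l. partition_of l n \<and> set l \<subseteq> good_parts}) =
      fps_nth (\<Prod>j\<in>?S. inverse (1 - fps_X ^ j :: complex fps)) n" .
  let ?D = "\<Prod>j\<in>?S. 1 - fps_X ^ j :: complex fps" and ?I =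
      "\<Prod>j\<in>?S. inverse (1 - fps_X ^ j :: complex fps)"
    and ?F = "fps_series UNIV (\<lambda>n. n^2) bailey_beta"
  have "?D * ?I = (\<Prod>j\<in>?S. 1)" unfolding prod.distrib[symmetric]
  proof (intro prod.cong refl)
    fix j assume "j \<in> ?S"
    hence "j \<noteq> 0" using good0 by (intro notI) simp
    thus "(1 - fps_X ^ j) * inverse (1 - fps_X ^ j) = (1 :: complex fps)"
      by (intro inverse_mult_eq_1') (simp add: fps_X_power_nth)
  qed
  hence DI: "?D * ?I = 1" by simp
  have "?I = (?F * eprod good_parts) * ?I"
    by (simp only: mod_18_identity mult_1_left)
  hence "fps_nth ?I n = fps_nth (eprod good_parts * (?F * ?I)) n"
    by (simp only: mult_ac)
  also have "\<dots> = fps_nth (?D * (?F * ?I)) n"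
    by (rule fps_mult_nth_cong) (auto intro!: eprod_nth)
  also have "?D * (?F * ?I) = (?D * ?I) * ?F" by (simp only: mult_ac)
  finally show ?thesis unfolding 1 DI by simp
qed

lemma mem_good_iff:
  "(\<exists>r \<in> {1, 3, 4, 6, 8}. [int p = r] (mod 18) \<or> [int p = - r] (mod 18)) \<longleftrightarrow> p \<in> good_parts"
proof -
  have "int p mod 18 = int (p mod 18)" by (simp add: zmod_int)
  thus ?thesis by (auto simp: cong_def good_parts_def)
qed

theorem theorem5p15:
  fixes n :: nat
  assumes "n > 0"
  shows "card {(\<pi>, \<nu>). signed_partition_of (\<pi>, \<nu>) (int n) \<and> \<pi> \<noteq> [] \<and>
            even (largest_part \<pi>) \<and>
            (\<forall>j \<in> {1..largest_part \<pi> div 2 - 1}. even (count_list \<pi> j) \<and> count_list \<pi> j \<ge> 2) \<and>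
            (\<forall>j \<in> {largest_part \<pi> div 2..largest_part \<pi>}. count_list \<pi> j \<ge> 1) \<and>
            length \<nu> = largest_part \<pi> div 2 \<and>
            (\<forall>p \<in> set \<nu>. [p = 2] (mod 3) \<and> p \<le> 3 * largest_part \<pi> div 2 - 1 \<and>
               (p > 2 \<longrightarrow> count_list \<nu> p \<le> 1))}
       = card {l. partition_of l n \<and>
            (\<forall>p \<in> set l. \<exists>r \<in> {1, 3, 4, 6, 8}.
               [int p = r] (mod 18) \<or> [int p = - r] (mod 18))}"
    (is "card ?L = card ?R")
proof -
  have "?L = (\<Union>m\<in>{1..n}. signed_class m n)"
  proof (intro equalityI subsetI)
    fix x assume x: "x \<in> ?L"
    obtain \<pi> \<nu> where xy: "x = (\<pi>, \<nu>)" by (cases x)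
    obtain m where m: "largest_part \<pi> = 2 * m" using x xy by (auto elim!: evenE)
    have "\<pi> \<noteq> []" "is_partition \<pi>" using x xy by (auto simp: signed_partition_of_def)
    hence "largest_part \<pi> > 0" by (cases \<pi>) (auto simp: is_partition_def largest_part_def)
    hence m1: "m \<ge> 1" using m by simp
    have "3 * (2 * m) div 2 - 1 = 3 * m - 1" by simp
    hence mem: "x \<in> signed_class m n" using x m unfolding xy signed_class_def by simp
    hence "\<not> m > n" using signed_class_empty by blast
    thus "x \<in> (\<Union>m\<in>{1..n}. signed_class m n)" using mem m1 by auto
  next
    fix x assume "x \<in> (\<Union>m\<in>{1..n}. signed_class m n)"
    then obtain m where m: "x \<in> signed_class m n" by auto
    obtain \<pi> \<nu> where xy: "x = (\<pi>, \<nu>)" by (cases x)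
    have "largest_part \<pi> = 2 * m" using m xy by (simp add: signed_class_def)
    thus "x \<in> ?L" using m unfolding xy signed_class_def by simp
  qed
  also have "card \<dots> = (\<Sum>m=1..n. card (signed_class m n))"
    by (rule card_UN_disjoint) (use signed_class_gf(1) in \<open>auto simp: signed_class_def\<close>)
  finally have "of_nat (card ?L) = (\<Sum>m=1..n. fps_nth (bailey_beta m * fps_X ^ (m^2)) n)"
    by (simp add: signed_class_gf(2))
  \<comment> \<open>the term for \<open>m = 0\<close> is the power series 1, whose coefficient at \<open>n > 0\<close> vanishes\<close>
  also have "\<dots> = (\<Sum>m\<le>n. fps_nth (bailey_beta m * fps_X ^ (m^2)) n)"
    using assms by (intro sum.mono_neutral_left) (auto simp: bailey_beta_def not_le)
  also have "\<dots> = fps_nth (fps_series UNIV (\<lambda>m. m^2) bailey_beta) n"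
    unfolding fps_sum_nth[symmetric]
    by (rule fps_series_nth_eq[symmetric, OF _ _ _ order_refl]) (auto intro: power2_nat_le_imp_le)
  also have "\<dots> = of_nat (card {l. partition_of l n \<and> set l \<subseteq> good_parts})"
    by (rule card_good_partitions [symmetric])
  also have "{l. partition_of l n \<and> set l \<subseteq> good_parts} = ?R"
    unfolding mem_good_iff by auto
  finally show ?thesis by (simp only: of_nat_eq_iff)
qed

end
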